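(* Let $n\ge2$. There is a constant $C$ depending only on $n$ such that for every function $\Omega$ on $\mathbb{R}^n\setminus\{0\}$ that is homogeneous of degree zero and satisfies $\Omega\in L^{n,\infty}(\mathbb{S}^{n-1})$, every $f\in C_c^\infty(\mathbb{R}^n)$ and every $x\in\mathbb{R}^n$, $$M_\Omega f(x)\le C\,\|\Omega\|_{L^{n,\infty}(\mathbb{S}^{n-1})}\,I_1(|\nabla f|)(x).$$
   Context: $M_\Omega f(x)=\sup_{t>0}\frac1{t^n}\int_{|y|<t}|\Omega(y)f(x-y)|\,dy$ is the rough maximal operator. $I_1g(x)=\int_{\mathbb{R}^n}\frac{g(y)}{|x-y|^{n-1}}\,dy$ is the Riesz potential of order 1. With $\sigma$ the surface measure on $\mathbb{S}^{n-1}$, $\|\Omega\|_{L^{n,\infty}(\mathbb{S}^{n-1})}=\sup_{t>0}t\,\sigma(\{y'\in\mathbb{S}^{n-1}:|\Omega(y')|>t\})^{1/n}$. *)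

theory Defs
  imports "HOL-Analysis.Analysis"
begin

text \<open>
  Surface measure on the unit sphere of \<open>\<real>\<^sup>n\<close>, as obtained from polar coordinates:
  \<open>\<sigma>(A) = n \<cdot> |{x. 0 < |x| \<le> 1 \<and> x/|x| \<in> A}|\<close>.  It is completed, so that the measurable
  functions are those in the sense of Lebesgue.
\<close>

definition sphere_measure :: "(real ^ 'n) measure" where
  "sphere_measure = completion (scale_measure (of_nat CARD('n))
     (distr (restrict_space lborel (cball 0 1 - {0})) (restrict_space borel (sphere 0 1))
        (\<lambda>x. x /\<^sub>R norm x)))"

text \<open>
  \<open>sup\<^bsub>t>0\<^esub> t \<sigma>(|\<Omega>| > t)\<^bsup>1/n\<^esup>\<close>, possibly infinite.  Using the real-valued \<^const>\<open>measure\<close>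
  loses nothing since \<open>\<sigma>\<close> is finite.
\<close>

definition weak_Ln_norm :: "(real ^ 'n \<Rightarrow> complex) \<Rightarrow> ennreal" where
  "weak_Ln_norm \<Omega> = (SUP t\<in>{0<..}. ennreal
     (t * measure (sphere_measure :: (real ^ 'n) measure) {\<theta>\<in>sphere 0 1. norm (\<Omega> \<theta>) > t}
            powr (1 / real CARD('n))))"

definition in_weak_Ln :: "(real ^ 'n \<Rightarrow> complex) \<Rightarrow> bool" where
  "in_weak_Ln \<Omega> \<longleftrightarrow> \<Omega> \<in> borel_measurable sphere_measure \<and> weak_Ln_norm \<Omega> < \<infinity>"

text \<open>Functions on \<open>\<real>\<^sup>n - {0}\<close> are total functions whose value at \<open>0\<close> is unconstrained and irrelevant.\<close>

definition homogeneous_deg0 :: "(real ^ 'n \<Rightarrow> complex) \<Rightarrow> bool" where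
  "homogeneous_deg0 \<Omega> \<longleftrightarrow> (\<forall>r>0. \<forall>x. x \<noteq> 0 \<longrightarrow> \<Omega> (r *\<^sub>R x) = \<Omega> x)"

definition partial_deriv :: "'n \<Rightarrow> (real ^ 'n \<Rightarrow> complex) \<Rightarrow> real ^ 'n \<Rightarrow> complex" where
  "partial_deriv i f x = frechet_derivative f (at x) (axis i 1)"

definition gradient :: "(real ^ 'n \<Rightarrow> complex) \<Rightarrow> real ^ 'n \<Rightarrow> complex ^ 'n" where
  "gradient f x = (\<chi> i. partial_deriv i f x)"

primrec Ck :: "nat \<Rightarrow> (real ^ 'n \<Rightarrow> complex) \<Rightarrow> bool" where
  "Ck 0 f \<longleftrightarrow> continuous_on UNIV f"
| "Ck (Suc k) f \<longleftrightarrow> f differentiable_on UNIV \<and> (\<forall>i. Ck k (partial_deriv i f))"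

definition test_function :: "(real ^ 'n \<Rightarrow> complex) \<Rightarrow> bool" where
  "test_function f \<longleftrightarrow> (\<forall>k. Ck k f) \<and> compact (closure {x. f x \<noteq> 0})"

definition rough_maximal ::
    "(real ^ 'n \<Rightarrow> complex) \<Rightarrow> (real ^ 'n \<Rightarrow> complex) \<Rightarrow> real ^ 'n \<Rightarrow> ennreal" where
  "rough_maximal \<Omega> f x = (SUP t\<in>{0<..}. ennreal (1 / t ^ CARD('n)) *
     (\<integral>\<^sup>+y\<in>ball 0 t. ennreal (norm (\<Omega> y * f (x - y))) \<partial>lebesgue))"

definition riesz_potential1 :: "(real ^ 'n \<Rightarrow> real) \<Rightarrow> real ^ 'n \<Rightarrow> real" where
  "riesz_potential1 g x = (\<integral>y. g y / norm (x - y) ^ (CARD('n) - 1) \<partial>lebesgue)"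

end

theory Submission
  imports Defs
begin

text \<open>
  Write \<open>n\<close> for the dimension, \<open>B\<^sub>t\<close> for the ball of radius \<open>t\<close> about \<open>0\<close> and \<open>N\<close> for the
  weak \<open>L\<^sup>n\<close> norm of \<open>\<Omega>\<close>.  A compactly supported \<open>C\<^sup>1\<close> function is dominated by the Riesz potential
  of its gradient, \<open>|f(u)| \<le> c \<integral> |\<nabla>f(z)| |z - u|\<^bsup>1-n\<^esup> dz\<close>
  (lemma \<open>norm_le_nn_integral_gradient\<close>).  Inserting this bound at \<open>u = x - y\<close> into
  \<open>\<integral>\<^bsub>B\<^sub>t\<^esub> |\<Omega>(y)| |f(x - y)| dy\<close> and exchanging the integrals
  (lemma \<open>nn_integral_weight_times_le\<close>) reduces the theorem to a statement about \<open>\<Omega>\<close> alone,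
  lemma \<open>ex_cone_kernel_bound\<close>:

  \<open>\<integral>\<^bsub>B\<^sub>t\<^esub> |\<Omega>(y)| |y - z|\<^bsup>1-n\<^esup> dy \<le> C N t\<^sup>n |z|\<^bsup>1-n\<^esup>\<close> for all \<open>z \<noteq> 0\<close> and \<open>t > 0\<close>.

  By scaling \<open>t = 1\<close> and \<open>N = 1\<close>.  If \<open>|z| \<ge> 2\<close> the kernel is comparable to \<open>|z|\<^bsup>1-n\<^esup>\<close> on \<open>B\<^sub>1\<close>, and
  \<open>\<Omega>\<close> is integrable there.  If \<open>|z| \<le> 2\<close> the left-hand side has to be bounded by a constant.  Duality
  of weak \<open>L\<^sup>n\<close> and weak \<open>L\<^bsup>n/(n-1)\<^esup>\<close> on \<open>\<real>\<^sup>n\<close> just fails to give this, by a logarithm, but the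
  homogeneity of \<open>\<Omega>\<close> leaves room: \<open>\<Omega>\<close> depends on \<open>n - 1\<close> variables only, and an exponent \<open>q < n\<close>
  with \<open>q > n - 1\<close> suffices.  Pointwise, with \<open>d = |y - z|\<close> and a suitable \<open>\<gamma> < n\<close>,

  \<open>|\<Omega>(y)| d\<^bsup>1-n\<^esup> \<le> d\<^bsup>-\<gamma>\<^esup> + d\<^bsup>-1/2\<^esup> |\<Omega>(y)|\<^sup>q\<close>

  (lemma \<open>mult_powr_le_split\<close>).  The first term is locally integrable.  In the second,
  \<open>d \<ge> ||y| - |z||\<close>, so that its singularity may be taken to depend on the radius \<open>|y|\<close> alone, while
  \<open>|\<Omega>|\<^sup>q\<close> depends on the direction alone; the radial factor \<open>||y| - |z||\<^bsup>-1/2\<^esup>\<close> is integrable, and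
  so is \<open>|\<Omega>|\<^sup>q\<close> over the sphere, because \<open>q < n\<close>.

  All integrals of powers are estimated in the same way, by
  \<open>nn_integral_powr_le_of_weak_type\<close>: a function of weak type \<open>p\<close> on a finite measure space is
  \<open>q\<close>-integrable for each \<open>q < p\<close>.
\<close>

section \<open>From weak type to integrability\<close>

lemma powr_le_dyadic_layers:
  fixes a q :: real
  assumes "0 \<le> a" "0 < q"
  shows "ennreal (a powr q) \<le> 1 + (\<Sum>k. ennreal (2 powr (real (Suc k) * q)) * indicator {2 ^ k<..} a)"
proof (cases "a \<le> 1")
  case True
  then have "a powr q \<le> 1"
    using assms by (simp add: powr_le1)
  then have "ennreal (a powr q) \<le> 1 + 0"
    by simp
  also have "\<dots> \<le> 1 + (\<Sum>k. ennreal (2 powr (real (Suc k) * q)) * indicator {2 ^ k<..} a)"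
    by (intro add_left_mono) simp
  finally show ?thesis .
next
  case False
  define m where "m = (LEAST m. a \<le> 2 ^ m)"
  have "\<exists>m. a \<le> 2 ^ m"
    using real_arch_pow[of 2 a] less_imp_le by auto
  then have m: "a \<le> 2 ^ m"
    unfolding m_def by (rule LeastI_ex)
  with False obtain k where k: "m = Suc k"
    by (cases m) auto
  have "\<not> a \<le> 2 ^ k"
    using not_less_Least[of k "\<lambda>m. a \<le> 2 ^ m"] k unfolding m_def by simp
  then have less: "2 ^ k < a"
    by simp
  have "a powr q \<le> (2 ^ Suc k) powr q"
    using m k assms by (intro powr_mono2) auto
  also have "\<dots> = 2 powr (real (Suc k) * q)"
    by (metis powr_powr powr_realpow zero_less_numeral)
  finally have "ennreal (a powr q) \<le> ennreal (2 powr (real (Suc k) * q)) * indicator {2 ^ k<..} a"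
    using less by (simp add: ennreal_leI)
  also have "\<dots> \<le> (\<Sum>k. ennreal (2 powr (real (Suc k) * q)) * indicator {2 ^ k<..} a)"
    using ennreal_suminf_lessD[of "\<lambda>k. ennreal (2 powr (real (Suc k) * q)) * indicator {2 ^ k<..} a"]
    by (meson leI less_irrefl)
  also have "\<dots> \<le> 1 + \<dots>"
    by simp
  finally show ?thesis .
qed

text \<open>
  The constant produced by summing the geometric series over the dyadic levels \<open>2\<^sup>k\<close>; the summand \<open>1\<close>
  accounts for the values below the first level.
\<close>

definition weak_type_const :: "real \<Rightarrow> real \<Rightarrow> real" where
  "weak_type_const p q = 1 + 2 powr q / (1 - 2 powr (q - p))"

text \<open>
  On the layer between \<open>2\<^sup>k\<close> and \<open>2\<^bsup>k+1\<^esup>\<close> the integrand is at most \<open>2\<^bsup>(k+1)q\<^esup>\<close>, and the layer has mass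
  at most \<open>K 2\<^bsup>-kp\<^esup>\<close>, so the layers contribute a geometric series with ratio \<open>2\<^bsup>q-p\<^esup> < 1\<close>.  The
  weight \<open>g\<close> makes the lemma applicable to restrictions and to measures with a singular density.
\<close>

lemma nn_integral_powr_le_of_weak_type:
  fixes g :: "'a \<Rightarrow> ennreal" and h :: "'a \<Rightarrow> real"
  assumes [measurable]: "g \<in> borel_measurable M" "h \<in> borel_measurable M"
    and nonneg: "\<And>x. 0 \<le> h x" and pq: "0 < q" "q < p"
    and total: "(\<integral>\<^sup>+x. g x \<partial>M) \<le> K"
    and tail: "\<And>s. 1 \<le> s \<Longrightarrow> (\<integral>\<^sup>+x. g x * indicator {s<..} (h x) \<partial>M) \<le> K * ennreal (s powr - p)"
  shows "(\<integral>\<^sup>+x. g x * ennreal (h x powr q) \<partial>M) \<le> K * ennreal (weak_type_const p q)"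
proof -
  let ?c = "\<lambda>k. ennreal (2 powr (real (Suc k) * q))"
  define r where "r = 2 powr (q - p)"
  have r: "0 < r" "r < 1"
    using pq powr_less_mono[of "q - p" 0 2] by (auto simp: r_def)
  have term_le: "?c k * (K * ennreal ((2 ^ k) powr - p)) = K * ennreal (2 powr q * r ^ k)" for k
  proof -
    have "2 powr (real (Suc k) * q) * (2 ^ k) powr - p = 2 powr (real (Suc k) * q) * 2 powr (real k * - p)"
      by (metis powr_powr powr_realpow zero_less_numeral)
    also have "\<dots> = 2 powr q * 2 powr ((q - p) * real k)"
      by (simp flip: powr_add add: algebra_simps)
    also have "\<dots> = 2 powr q * r ^ k"
      by (simp add: r_def powr_power mult.commute)
    finally have "2 powr (real (Suc k) * q) * (2 ^ k) powr - p = 2 powr q * r ^ k" .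
    then show ?thesis
      by (simp add: mult.left_commute flip: ennreal_mult)
  qed
  have "(\<integral>\<^sup>+x. g x * ennreal (h x powr q) \<partial>M)
      \<le> (\<integral>\<^sup>+x. g x * (1 + (\<Sum>k. ?c k * indicator {2 ^ k<..} (h x))) \<partial>M)"
    by (intro nn_integral_mono mult_left_mono powr_le_dyadic_layers nonneg pq) auto
  also have "\<dots> = (\<integral>\<^sup>+x. g x + (\<Sum>k. ?c k * (g x * indicator {2 ^ k<..} (h x))) \<partial>M)"
    by (simp add: distrib_left mult.left_commute flip: ennreal_suminf_cmult)
  also have "\<dots> = (\<integral>\<^sup>+x. g x \<partial>M) + (\<Sum>k. ?c k * (\<integral>\<^sup>+x. g x * indicator {2 ^ k<..} (h x) \<partial>M))"
    by (simp add: nn_integral_add nn_integral_suminf nn_integral_cmult)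
  also have "\<dots> \<le> K + (\<Sum>k. ?c k * (K * ennreal ((2 ^ k) powr - p)))"
    by (intro add_mono total suminf_le summableI mult_left_mono tail) auto
  also have "\<dots> = K + K * (\<Sum>k. ennreal (2 powr q * r ^ k))"
    by (simp only: term_le ennreal_suminf_cmult)
  also have "(\<Sum>k. ennreal (2 powr q * r ^ k)) = ennreal (2 powr q / (1 - r))"
  proof (rule suminf_ennreal_eq)
    show "(\<lambda>k. 2 powr q * r ^ k) sums (2 powr q / (1 - r))"
      using geometric_sums[of r, THEN sums_mult, of "2 powr q"] r by simp
  qed (use r in auto)
  also have "K + K * ennreal (2 powr q / (1 - r)) = K * ennreal (weak_type_const p q)"
    using r by (simp add: weak_type_const_def r_def distrib_left flip: ennreal_1 ennreal_plus)
      (simp add: distrib_left)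
  finally show ?thesis .
qed

lemma weak_type_const_nonneg: "q < p \<Longrightarrow> 0 \<le> weak_type_const p q"
  using powr_less_mono[of "q - p" 0 2] by (simp add: weak_type_const_def)

section \<open>Cones and singular integrals over balls\<close>

declare borel_open[OF open_ball, measurable]

lemma nn_integral_lborel_affine:
  fixes f :: "'a::euclidean_space \<Rightarrow> ennreal"
  assumes [measurable]: "f \<in> borel_measurable borel" and c: "c \<noteq> 0"
  shows "(\<integral>\<^sup>+x. f x \<partial>lborel) = ennreal (\<bar>c\<bar> ^ DIM('a)) * (\<integral>\<^sup>+x. f (t + c *\<^sub>R x) \<partial>lborel)"
  by (subst lborel_affine[OF c, of t])
     (simp add: nn_integral_density nn_integral_distr nn_integral_cmult)

lemma emeasure_cone_ball:
  fixes E :: "'a::euclidean_space set"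
  assumes [measurable]: "E \<in> sets borel" and cone: "\<And>r x. 0 < r \<Longrightarrow> x \<noteq> 0 \<Longrightarrow> r *\<^sub>R x \<in> E \<longleftrightarrow> x \<in> E"
    and r: "0 \<le> r"
  shows "emeasure lborel (E \<inter> ball 0 r) = ennreal (r ^ DIM('a)) * emeasure lborel (E \<inter> ball 0 1)"
proof (cases "r = 0")
  case True
  then show ?thesis by simp
next
  case False
  with r have r: "0 < r" by simp
  have "r *\<^sub>R x \<in> E \<inter> ball 0 r \<longleftrightarrow> x \<in> E \<inter> ball 0 1" if "x \<noteq> 0" for x
    using r cone[OF r that] by simp
  then have "(\<integral>\<^sup>+x. indicator (E \<inter> ball 0 r) (0 + r *\<^sub>R x) \<partial>lborel)
      = (\<integral>\<^sup>+x. indicator (E \<inter> ball 0 1) x \<partial>lborel)"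
    using AE_lborel_singleton[of "0 :: 'a"] by (intro nn_integral_cong_AE) (auto elim!: eventually_mono simp: indicator_def)
  moreover have sets: "E \<inter> ball 0 r' \<in> sets borel" for r'
    by measurable
  then have "(indicator (E \<inter> ball 0 r) :: 'a \<Rightarrow> ennreal) \<in> borel_measurable borel"
    by (rule borel_measurable_indicator)
  ultimately show ?thesis
    using nn_integral_lborel_affine[of "indicator (E \<inter> ball 0 r)" r 0] r sets by simp
qed

lemma inverse_powr_eq_powr_minus:
  fixes a :: real
  shows "0 \<le> a \<Longrightarrow> inverse a powr p = a powr - p"
  by (simp add: inverse_powr powr_minus)

text \<open>
  The function \<open>1/|y - z|\<close> is of weak type \<open>n\<close>, since its superlevel sets are balls about \<open>z\<close>.
\<close>

lemma ex_nn_integral_norm_powr_ball_bound: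
  fixes r p :: real
  assumes p: "0 < p" "p < real (DIM('a::euclidean_space))"
  shows "\<exists>C\<ge>0. \<forall>z::'a. (\<integral>\<^sup>+y. indicator (ball z r) y * ennreal (norm (y - z) powr - p) \<partial>lborel) \<le> ennreal C"
proof -
  define n where "n = DIM('a)"
  define V where "V = unit_ball_vol (real n)"
  define R where "R = max 1 r"
  have V: "0 \<le> V" by (simp add: V_def)
  let ?C = "V * R ^ n * weak_type_const (real n) p"
  have "(\<integral>\<^sup>+y. indicator (ball z r) y * ennreal (norm (y - z) powr - p) \<partial>lborel) \<le> ennreal ?C" for z :: 'a
  proof -
    have "(\<integral>\<^sup>+y. indicator (ball z r) y * ennreal (inverse (norm (y - z)) powr p) \<partial>lborel)
        \<le> ennreal (V * R ^ n) * ennreal (weak_type_const (real n) p)"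
    proof (rule nn_integral_powr_le_of_weak_type)
      have "emeasure lborel (ball z r) \<le> emeasure lborel (ball z R)"
        by (intro emeasure_mono) (auto simp: R_def)
      also have "\<dots> = ennreal (V * R ^ n)"
        by (simp add: emeasure_ball V_def n_def R_def)
      finally show "(\<integral>\<^sup>+y. indicator (ball z r) y \<partial>lborel) \<le> ennreal (V * R ^ n)"
        by simp
    next
      fix s :: real assume s: "1 \<le> s"
      have sub: "y \<in> ball z (1 / s)" if "s < inverse (norm (y - z))" for y
        using that s by (cases "y = z") (auto simp: dist_norm norm_minus_commute field_simps)
      have "(\<integral>\<^sup>+y. indicator (ball z r) y * indicator {s<..} (inverse (norm (y - z))) \<partial>lborel)
          \<le> (\<integral>\<^sup>+y. indicator (ball z (1 / s)) y \<partial>lborel)"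
        using sub by (intro nn_integral_mono) (auto simp: indicator_def)
      also have "\<dots> = ennreal (V * (1 / s) ^ n)"
        using s by (simp add: emeasure_ball V_def n_def)
      also have "(1 / s) ^ n = s powr - real n"
        using s by (simp add: powr_minus powr_realpow power_one_over inverse_eq_divide)
      also have "ennreal (V * s powr - real n) \<le> ennreal (V * R ^ n * s powr - real n)"
        using V mult_left_mono[OF one_le_power[of R n] V]
        by (intro ennreal_leI mult_right_mono) (auto simp: R_def)
      finally show "(\<integral>\<^sup>+y. indicator (ball z r) y * indicator {s<..} (inverse (norm (y - z))) \<partial>lborel)
          \<le> ennreal (V * R ^ n) * ennreal (s powr - real n)"
        using V by (simp add: ennreal_mult R_def)
    qed (use p in \<open>auto simp: n_def intro!: borel_measurable_indicator\<close>)
    then show ?thesis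
      using V weak_type_const_nonneg[of p n] p
      by (simp add: inverse_powr_eq_powr_minus R_def n_def flip: ennreal_mult)
  qed
  then show ?thesis
    using V weak_type_const_nonneg[of p n] p by (intro exI[of _ ?C]) (auto simp: R_def n_def)
qed

lemma power_diff_le_mult_diff:
  fixes a b :: real
  assumes "0 \<le> a" "a \<le> b" "b \<le> 1"
  shows "b ^ n - a ^ n \<le> real n * (b - a)"
proof (induction n)
  case (Suc n)
  have "b ^ Suc n - a ^ Suc n = b * (b ^ n - a ^ n) + a ^ n * (b - a)"
    by (simp add: algebra_simps)
  also have "\<dots> \<le> 1 * (b ^ n - a ^ n) + 1 * (b - a)"
    using assms by (intro add_mono mult_right_mono) (auto intro: power_mono power_le_one)
  also have "\<dots> \<le> real (Suc n) * (b - a)"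
    using Suc by (simp add: algebra_simps)
  finally show ?case .
qed simp

text \<open>
  The substitute for polar coordinates: on a cone, a function of the radius integrates to a multiple of
  the measure of the cone's directions.  Here \<open>1/||y| - \<rho>|\<close> is of weak type \<open>1\<close>, because its superlevel
  sets are spherical shells of thickness at most \<open>2/s\<close>, and the shells of the cone have a measure
  proportional to that of the cone itself.
\<close>

lemma nn_integral_cone_radial_singularity:
  fixes E :: "'a::euclidean_space set" and \<alpha> \<rho> :: real
  assumes [measurable]: "E \<in> sets borel"
    and cone: "\<And>r x. 0 < r \<Longrightarrow> x \<noteq> 0 \<Longrightarrow> r *\<^sub>R x \<in> E \<longleftrightarrow> x \<in> E"
    and \<alpha>: "0 < \<alpha>" "\<alpha> < 1"
  shows "(\<integral>\<^sup>+y. indicator (E \<inter> ball 0 1) y * ennreal (\<bar>norm y - \<rho>\<bar> powr - \<alpha>) \<partial>lborel)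
      \<le> ennreal (2 * real DIM('a) * weak_type_const 1 \<alpha>) * emeasure lborel (E \<inter> ball 0 1)"
proof -
  define n where "n = DIM('a)"
  have n: "1 \<le> n" by (simp add: n_def DIM_positive Suc_leI)
  have "emeasure lborel (E \<inter> ball 0 1) \<le> emeasure lborel (ball 0 1 :: 'a set)"
    by (intro emeasure_mono) auto
  also have "\<dots> < \<infinity>"
    by (simp add: emeasure_ball)
  finally obtain v where v: "emeasure lborel (E \<inter> ball 0 1) = ennreal v" "0 \<le> v"
    by (cases "emeasure lborel (E \<inter> ball 0 1)") auto
  have "(\<integral>\<^sup>+y. indicator (E \<inter> ball 0 1) y * ennreal (inverse \<bar>norm y - \<rho>\<bar> powr \<alpha>) \<partial>lborel)
      \<le> ennreal (2 * real n * v) * ennreal (weak_type_const 1 \<alpha>)"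
  proof (rule nn_integral_powr_le_of_weak_type)
    show "(\<integral>\<^sup>+y. indicator (E \<inter> ball 0 1) y \<partial>lborel) \<le> ennreal (2 * real n * v)"
      using v n mult_right_mono[of 1 "2 * real n" v] by (simp add: ennreal_leI)
  next
    fix s :: real assume s: "1 \<le> s"
    define a b where "a = max 0 (\<rho> - 1 / s)" and "b = min 1 (\<rho> + 1 / s)"
    have near: "a \<le> norm y \<and> norm y < b" if "y \<in> ball 0 1" "s < inverse \<bar>norm y - \<rho>\<bar>" for y :: 'a
    proof -
      have "\<bar>norm y - \<rho>\<bar> < 1 / s"
        using that s by (cases "norm y = \<rho>") (auto simp: field_simps)
      then show ?thesis
        using that by (auto simp: a_def b_def)
    qed
    \<comment> \<open>The shell is empty, and \<open>b < a\<close> possible, when \<open>\<rho>\<close> is more than \<open>1/s\<close> away from the unit interval.\<close>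
    show "(\<integral>\<^sup>+y. indicator (E \<inter> ball 0 1) y * indicator {s<..} (inverse \<bar>norm y - \<rho>\<bar>) \<partial>lborel)
        \<le> ennreal (2 * real n * v) * ennreal (s powr - 1)"
    proof (cases "a \<le> b")
      case False
      then have "\<not> (y \<in> ball 0 1 \<and> s < inverse \<bar>norm y - \<rho>\<bar>)" for y :: 'a
        using near[of y] by auto
      then have "(\<lambda>y::'a. indicator (E \<inter> ball 0 1) y * indicator {s<..} (inverse \<bar>norm y - \<rho>\<bar>)) = (\<lambda>y. 0 :: ennreal)"
        by (auto simp: indicator_def fun_eq_iff)
      then show ?thesis by simp
    next
      case True
      have ab: "0 \<le> a" "b \<le> 1" "b - a \<le> 2 / s"
        by (auto simp: a_def b_def)
      have fin: "emeasure lborel (E \<inter> ball 0 a) \<noteq> \<infinity>"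
        using emeasure_cone_ball[OF assms(1) cone, of a] ab v by (simp add: ennreal_mult_eq_top_iff)
      have "(\<integral>\<^sup>+y. indicator (E \<inter> ball 0 1) y * indicator {s<..} (inverse \<bar>norm y - \<rho>\<bar>) \<partial>lborel)
          \<le> (\<integral>\<^sup>+y. indicator (E \<inter> ball 0 b - E \<inter> ball 0 a) y \<partial>lborel)"
        using near by (intro nn_integral_mono) (fastforce simp: indicator_def)
      also have "\<dots> = emeasure lborel (E \<inter> ball 0 b) - emeasure lborel (E \<inter> ball 0 a)"
        using True fin by (subst nn_integral_indicator) (auto intro!: emeasure_Diff)
      also have "\<dots> = ennreal (b ^ n * v) - ennreal (a ^ n * v)"
        using emeasure_cone_ball[OF assms(1) cone, of a] emeasure_cone_ball[OF assms(1) cone, of b] ab True v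
        by (simp add: n_def ennreal_mult)
      also have "\<dots> = ennreal ((b ^ n - a ^ n) * v)"
        using ab v by (simp add: ennreal_minus left_diff_distrib)
      also have "\<dots> \<le> ennreal (real n * (2 / s) * v)"
        using order_trans[OF power_diff_le_mult_diff[OF ab(1) True ab(2), of n] mult_left_mono[OF ab(3), of "real n"]] v
        by (intro ennreal_leI mult_right_mono) auto
      also have "\<dots> = ennreal (2 * real n * v) * ennreal (s powr - 1)"
        using v s by (simp add: powr_minus field_simps flip: ennreal_mult)
      finally show ?thesis .
    qed
  qed (use \<alpha> in \<open>auto intro!: borel_measurable_indicator\<close>)
  also have "\<dots> = ennreal (2 * real DIM('a) * weak_type_const 1 \<alpha>) * emeasure lborel (E \<inter> ball 0 1)"
    using v weak_type_const_nonneg[of \<alpha> 1] \<alpha> by (simp add: n_def mult_ac flip: ennreal_mult)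
  finally show ?thesis
    by (simp add: inverse_powr_eq_powr_minus)
qed

section \<open>Homogeneous weights against the Riesz kernel\<close>

text \<open>
  The two terms on the right correspond to \<open>w \<le> d\<^bsup>-\<beta>\<^esup>\<close> and \<open>w > d\<^bsup>-\<beta>\<^esup>\<close>, where
  \<open>\<beta> = (n - 3/2)/(n - 5/4)\<close>.  It is essential that \<open>\<beta> < 1\<close>, so that the first exponent stays below \<open>n\<close>;
  that \<open>d\<close> is left with an exponent below \<open>1\<close> in the second term, so that it remains integrable as a
  singularity in the radius alone; and that \<open>w\<close> has there an exponent below \<open>n\<close>.  With \<open>1/2\<close> for the
  power of \<open>d\<close> and \<open>n - 1/4\<close> for that of \<open>w\<close>, the value of \<open>\<beta>\<close> is forced by
  \<open>\<beta> (n - 5/4) = n - 3/2\<close>.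
\<close>

lemma mult_powr_le_split:
  fixes d w n :: real
  assumes d: "0 < d" and w: "0 \<le> w" and n: "2 \<le> n"
  shows "w * d powr (1 - n) \<le> d powr - (n - 1 + (n - 3/2) / (n - 5/4)) + d powr - (1/2) * w powr (n - 1/4)"
proof -
  define \<beta> where "\<beta> = (n - 3/2) / (n - 5/4)"
  have \<beta>: "0 < \<beta>" "\<beta> * (n - 5/4) = n - 3/2"
    using n by (auto simp: \<beta>_def)
  show ?thesis
  proof (cases "w \<le> d powr - \<beta>")
    case True
    then have "w * d powr (1 - n) \<le> d powr - \<beta> * d powr (1 - n)"
      by (intro mult_right_mono) auto
    also have "\<dots> = d powr - (n - 1 + \<beta>)"
      by (simp flip: powr_add add: algebra_simps)
    finally show ?thesis
      by (simp add: \<beta>_def add_increasing2)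
  next
    case False
    moreover have "0 < d powr - \<beta>"
      using d by simp
    ultimately have "0 < w"
      by linarith
    have "d powr - (n - 3/2) = (d powr - \<beta>) powr (n - 5/4)"
      by (simp add: powr_powr \<beta>)
    also have "\<dots> \<le> w powr (n - 5/4)"
      using False n by (intro powr_mono2) auto
    finally have "w * d powr - (n - 3/2) * d powr - (1/2) \<le> w * w powr (n - 5/4) * d powr - (1/2)"
      using w by (intro mult_right_mono mult_left_mono) auto
    also have "w * w powr (n - 5/4) = w powr (n - 1/4)"
      using \<open>0 < w\<close> powr_add[of w 1 "n - 5/4"] by simp
    also have "w * d powr - (n - 3/2) * d powr - (1/2) = w * d powr (1 - n)"
      by (simp add: mult.assoc flip: powr_add)
    finally show ?thesis
      by (simp add: mult.commute add_increasing)
  qed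
qed

text \<open>
  The conditions under which \<open>|\<Omega>|\<close> enters, after modification on a null set to make it Borel.  By
  homogeneity, the tail condition on the unit ball says that \<open>w\<close> is in weak \<open>L\<^sup>n\<close> of the sphere, with
  norm at most \<open>n\<^bsup>1/n\<^esup> N\<close>.
\<close>

definition weak_homogeneous_weight :: "real \<Rightarrow> ('a::euclidean_space \<Rightarrow> real) \<Rightarrow> bool" where
  "weak_homogeneous_weight N w \<longleftrightarrow> w \<in> borel_measurable borel \<and> (\<forall>y. 0 \<le> w y) \<and>
     (\<forall>r>0. \<forall>y. y \<noteq> 0 \<longrightarrow> w (r *\<^sub>R y) = w y) \<and>
     (\<forall>s>0. emeasure lborel ({y. s < w y} \<inter> ball 0 1) \<le> ennreal ((s / N) powr - real DIM('a)))"

text \<open>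
  For \<open>|z| \<le> 2\<close> the right-hand side is bounded below, and the integrand is split into a Riesz kernel of
  integrable order and the product of a power of \<open>w\<close> with a radial singularity.  The latter product is
  integrated by the weak-type lemma for \<open>w\<close> with the radial singularity as density, the superlevel sets
  of \<open>w\<close> being cones.
\<close>

lemma ex_cone_kernel_bound_unit:
  assumes dim: "2 \<le> DIM('a::euclidean_space)"
  shows "\<exists>C\<ge>0. \<forall>w (z::'a). weak_homogeneous_weight 1 w \<longrightarrow> z \<noteq> 0 \<longrightarrow>
    (\<integral>\<^sup>+y. indicator (ball 0 1) y * ennreal (w y * norm (y - z) powr (1 - real DIM('a))) \<partial>lborel)
      \<le> ennreal (C * norm z powr (1 - real DIM('a)))"
proof -
  define n where "n = real DIM('a)"
  have n: "2 \<le> n" using dim by (simp add: n_def)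
  define \<gamma> where "\<gamma> = n - 1 + (n - 3/2) / (n - 5/4)"
  have \<gamma>: "0 < \<gamma>" "\<gamma> < n"
    using n by (auto simp: \<gamma>_def divide_less_eq intro!: add_pos_pos)
  obtain C1 where C1: "0 \<le> C1"
    "\<And>z::'a. (\<integral>\<^sup>+y. indicator (ball z 3) y * ennreal (norm (y - z) powr - \<gamma>) \<partial>lborel) \<le> ennreal C1"
    using ex_nn_integral_norm_powr_ball_bound[of \<gamma> 3, where 'a='a] \<gamma> by (auto simp: n_def)
  define C2 where "C2 = 2 * n * weak_type_const 1 (1/2)"
  have C2: "0 \<le> C2"
    using weak_type_const_nonneg[of "1/2" 1] n by (simp add: C2_def)
  define V where "V = max 1 (unit_ball_vol n)"
  have V: "1 \<le> V" by (simp add: V_def)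
  have volume: "emeasure lborel (ball 0 1 :: 'a set) \<le> ennreal V"
    by (simp add: emeasure_ball V_def n_def ennreal_leI)
  define C3 where "C3 = C1 + C2 * V * weak_type_const n (n - 1/4)"
  define C4 where "C4 = V * weak_type_const n 1"
  have C34: "0 \<le> C3" "0 \<le> C4"
    using C1 C2 V n weak_type_const_nonneg[of "n - 1/4" n] weak_type_const_nonneg[of 1 n]
    by (auto simp: C3_def C4_def)
  have "(\<integral>\<^sup>+y. indicator (ball 0 1) y * ennreal (w y * norm (y - z) powr (1 - n)) \<partial>lborel)
      \<le> ennreal (2 powr (n - 1) * (C3 + C4) * norm z powr (1 - n))"
    if weight: "weak_homogeneous_weight 1 w" and z: "z \<noteq> 0" for w and z :: 'a
  proof -
    from weight have [measurable]: "w \<in> borel_measurable borel" and w: "\<And>y. 0 \<le> w y"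
      and hom: "\<And>r y. 0 < r \<Longrightarrow> y \<noteq> 0 \<Longrightarrow> w (r *\<^sub>R y) = w y"
      and weak: "\<And>s. 0 < s \<Longrightarrow> emeasure lborel ({y. s < w y} \<inter> ball 0 1) \<le> ennreal (s powr - n)"
      by (auto simp: weak_homogeneous_weight_def n_def)
    show ?thesis
    proof (cases "norm z \<le> 2")
      case True
      define g :: "'a \<Rightarrow> ennreal" where
        "g y = indicator (ball 0 1) y * ennreal (\<bar>norm y - norm z\<bar> powr - (1/2))" for y
      have [measurable]: "g \<in> borel_measurable borel"
        unfolding g_def by measurable
      have cone: "(\<integral>\<^sup>+y. g y * indicator E y \<partial>lborel) \<le> ennreal C2 * emeasure lborel (E \<inter> ball 0 1)"
        if "E \<in> sets borel" "\<And>r x. 0 < r \<Longrightarrow> x \<noteq> 0 \<Longrightarrow> r *\<^sub>R x \<in> E \<longleftrightarrow> x \<in> E" for E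
      proof -
        have "(\<integral>\<^sup>+y. g y * indicator E y \<partial>lborel)
            = (\<integral>\<^sup>+y. indicator (E \<inter> ball 0 1) y * ennreal (\<bar>norm y - norm z\<bar> powr - (1/2)) \<partial>lborel)"
          by (intro nn_integral_cong) (auto simp: g_def indicator_def)
        also have "\<dots> \<le> ennreal C2 * emeasure lborel (E \<inter> ball 0 1)"
          unfolding C2_def n_def using that by (intro nn_integral_cone_radial_singularity) auto
        finally show ?thesis .
      qed
      have part2: "(\<integral>\<^sup>+y. g y * ennreal (w y powr (n - 1/4)) \<partial>lborel)
          \<le> ennreal (C2 * V) * ennreal (weak_type_const n (n - 1/4))"
      proof (rule nn_integral_powr_le_of_weak_type)
        have "(\<integral>\<^sup>+y. g y \<partial>lborel) \<le> ennreal C2 * emeasure lborel (ball 0 1 :: 'a set)"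
          using cone[of UNIV] by simp
        also have "\<dots> \<le> ennreal C2 * ennreal V"
          by (intro mult_left_mono volume) auto
        finally show "(\<integral>\<^sup>+y. g y \<partial>lborel) \<le> ennreal (C2 * V)"
          using C2 V by (simp add: ennreal_mult)
      next
        fix s :: real assume s: "1 \<le> s"
        have "(\<integral>\<^sup>+y. g y * indicator {s<..} (w y) \<partial>lborel) = (\<integral>\<^sup>+y. g y * indicator {y. s < w y} y \<partial>lborel)"
          by (intro nn_integral_cong) (auto simp: indicator_def)
        also have "\<dots> \<le> ennreal C2 * emeasure lborel ({y. s < w y} \<inter> ball 0 1)"
          using hom by (intro cone) auto
        also have "\<dots> \<le> ennreal C2 * ennreal (s powr - n)"
          using s by (intro mult_left_mono weak) auto
        also have "\<dots> \<le> ennreal (C2 * V) * ennreal (s powr - n)"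
          using C2 V mult_left_mono[OF V C2] by (intro mult_right_mono ennreal_leI) auto
        finally show "(\<integral>\<^sup>+y. g y * indicator {s<..} (w y) \<partial>lborel) \<le> ennreal (C2 * V) * ennreal (s powr - n)" .
      qed (use n w in auto)
      \<comment> \<open>On \<open>|y| = |z|\<close> the value of the radial singularity is \<open>0 powr - (1/2) = 0\<close>, which is no upper bound.\<close>
      have "AE y in lborel. y \<noteq> z"
        by (rule AE_lborel_singleton)
      moreover have "AE y::'a in lborel. y \<notin> sphere 0 (norm z)"
      proof -
        have "sphere 0 (norm z) \<in> null_sets (lborel :: 'a measure)"
          using negligible_sphere[of "0::'a" "norm z"] by (simp add: negligible_iff_null_sets null_sets_completion_iff)
        then show ?thesis by (rule AE_not_in)
      qed
      ultimately have pointwise: "AE y in lborel. indicator (ball 0 1) y * ennreal (w y * norm (y - z) powr (1 - n))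
          \<le> indicator (ball z 3) y * ennreal (norm (y - z) powr - \<gamma>) + g y * ennreal (w y powr (n - 1/4))"
      proof eventually_elim
        case (elim y)
        show ?case
        proof (cases "y \<in> ball 0 1")
          case y: True
          have "norm (y - z) \<le> norm y + norm z"
            by (rule norm_triangle_ineq4)
          then have y3: "y \<in> ball z 3"
            using y \<open>norm z \<le> 2\<close> by (simp add: dist_norm norm_minus_commute)
          have d: "0 < norm (y - z)" and \<rho>: "0 < \<bar>norm y - norm z\<bar>"
            using elim by auto
          have "w y * norm (y - z) powr (1 - n)
              \<le> norm (y - z) powr - \<gamma> + norm (y - z) powr - (1/2) * w y powr (n - 1/4)"
            unfolding \<gamma>_def using d w n by (rule mult_powr_le_split)
          also have "\<dots> \<le> norm (y - z) powr - \<gamma> + \<bar>norm y - norm z\<bar> powr - (1/2) * w y powr (n - 1/4)"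
            using \<rho> by (intro add_left_mono mult_right_mono powr_mono2' norm_triangle_ineq3) auto
          finally show ?thesis
            using y y3 by (simp add: g_def ennreal_leI flip: ennreal_mult ennreal_plus)
        qed simp
      qed
      have "(\<integral>\<^sup>+y. indicator (ball 0 1) y * ennreal (w y * norm (y - z) powr (1 - n)) \<partial>lborel)
          \<le> (\<integral>\<^sup>+y. indicator (ball z 3) y * ennreal (norm (y - z) powr - \<gamma>) + g y * ennreal (w y powr (n - 1/4)) \<partial>lborel)"
        using pointwise by (rule nn_integral_mono_AE)
      also have "\<dots> \<le> ennreal C1 + ennreal (C2 * V) * ennreal (weak_type_const n (n - 1/4))"
        by (subst nn_integral_add) (auto intro!: add_mono C1 part2)
      also have "\<dots> = ennreal C3"
        using C1 C2 V weak_type_const_nonneg[of "n - 1/4" n] by (simp add: C3_def flip: ennreal_mult ennreal_plus)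
      also have "\<dots> \<le> ennreal (2 powr (n - 1) * (C3 + C4) * norm z powr (1 - n))"
      proof (rule ennreal_leI)
        have "1 = 2 powr (n - 1) * 2 powr (1 - n)"
          by (simp flip: powr_add)
        also have "\<dots> \<le> 2 powr (n - 1) * norm z powr (1 - n)"
          using True z n by (intro mult_left_mono powr_mono2') auto
        finally have "(C3 + C4) * 1 \<le> (C3 + C4) * (2 powr (n - 1) * norm z powr (1 - n))"
          using C34 by (intro mult_left_mono) auto
        then show "C3 \<le> 2 powr (n - 1) * (C3 + C4) * norm z powr (1 - n)"
          using C34 by (simp add: mult_ac)
      qed
      finally show ?thesis .
    next
      case False
      let ?c = "ennreal (2 powr (n - 1) * norm z powr (1 - n))"
      have "(\<integral>\<^sup>+y. indicator (ball 0 1) y * ennreal (w y * norm (y - z) powr (1 - n)) \<partial>lborel)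
          \<le> (\<integral>\<^sup>+y. ?c * (indicator (ball 0 1) y * ennreal (w y powr 1)) \<partial>lborel)"
      proof (rule nn_integral_mono)
        fix y :: 'a
        show "indicator (ball 0 1) y * ennreal (w y * norm (y - z) powr (1 - n))
          \<le> ?c * (indicator (ball 0 1) y * ennreal (w y powr 1))"
        proof (cases "y \<in> ball 0 1")
          case True
          have "norm z / 2 \<le> norm (y - z)"
            using norm_triangle_ineq2[of z y] True False by (simp add: norm_minus_commute)
          then have "norm (y - z) powr (1 - n) \<le> (norm z / 2) powr (1 - n)"
            using z n by (intro powr_mono2') auto
          also have "\<dots> = 2 powr (n - 1) * norm z powr (1 - n)"
            using powr_minus_divide[of 2 "1 - n"] by (simp add: powr_divide powr_minus_divide)
          finally have "w y * norm (y - z) powr (1 - n) \<le> w y * (2 powr (n - 1) * norm z powr (1 - n))"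
            by (intro mult_left_mono w)
          then show ?thesis
            using True w by (simp add: mult_ac ennreal_leI flip: ennreal_mult)
        qed simp
      qed
      also have "\<dots> = ?c * (\<integral>\<^sup>+y. indicator (ball 0 1) y * ennreal (w y powr 1) \<partial>lborel)"
        by (rule nn_integral_cmult) simp
      also have "\<dots> \<le> ?c * (ennreal V * ennreal (weak_type_const n 1))"
      proof (intro mult_left_mono nn_integral_powr_le_of_weak_type)
        show "(\<integral>\<^sup>+y. indicator (ball (0::'a) 1) y \<partial>lborel) \<le> ennreal V"
          using volume by simp
      next
        fix s :: real assume s: "1 \<le> s"
        have "(\<integral>\<^sup>+y. indicator (ball 0 1) y * indicator {s<..} (w y) \<partial>lborel)
            = (\<integral>\<^sup>+y. indicator ({y. s < w y} \<inter> ball 0 1) y \<partial>lborel)"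
          by (intro nn_integral_cong) (auto simp: indicator_def)
        also have "\<dots> \<le> ennreal (s powr - n)"
          using weak[of s] s by simp
        also have "\<dots> \<le> ennreal V * ennreal (s powr - n)"
          using V mult_right_mono[OF V, of "s powr - n"] by (simp add: ennreal_leI flip: ennreal_mult)
        finally show "(\<integral>\<^sup>+y. indicator (ball 0 1) y * indicator {s<..} (w y) \<partial>lborel) \<le> ennreal V * ennreal (s powr - n)" .
      qed (use n w in \<open>auto intro!: borel_measurable_indicator\<close>)
      also have "\<dots> \<le> ennreal (2 powr (n - 1) * (C3 + C4) * norm z powr (1 - n))"
        using C34 V weak_type_const_nonneg[of 1 n] n
        by (auto simp: C4_def[symmetric] algebra_simps simp flip: ennreal_mult intro!: ennreal_leI)
      finally show ?thesis .
    qed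
  qed
  then show ?thesis
    using C34 by (intro exI[of _ "2 powr (n - 1) * (C3 + C4)"]) (simp add: n_def)
qed

text \<open>
  Substitute \<open>t y\<close> for \<open>y\<close> and divide \<open>w\<close> by \<open>N\<close>.
\<close>

lemma ex_cone_kernel_bound:
  assumes dim: "2 \<le> DIM('a::euclidean_space)"
  shows "\<exists>C\<ge>0. \<forall>w N t (z::'a). weak_homogeneous_weight N w \<longrightarrow> 0 < N \<longrightarrow> 0 < t \<longrightarrow> z \<noteq> 0 \<longrightarrow>
    (\<integral>\<^sup>+y. indicator (ball 0 t) y * ennreal (w y * norm (y - z) powr (1 - real DIM('a))) \<partial>lborel)
      \<le> ennreal (C * N * t ^ DIM('a) * norm z powr (1 - real DIM('a)))"
proof -
  define n where "n = real DIM('a)"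
  obtain C where C: "0 \<le> C" and unit:
    "\<And>w z :: 'a. weak_homogeneous_weight 1 w \<Longrightarrow> z \<noteq> 0 \<Longrightarrow>
    (\<integral>\<^sup>+y. indicator (ball 0 1) y * ennreal (w y * norm (y - z) powr (1 - n)) \<partial>lborel)
      \<le> ennreal (C * norm z powr (1 - n))"
    using ex_cone_kernel_bound_unit[OF dim] unfolding n_def by blast
  have "(\<integral>\<^sup>+y. indicator (ball 0 t) y * ennreal (w y * norm (y - z) powr (1 - n)) \<partial>lborel)
      \<le> ennreal (C * N * t ^ DIM('a) * norm z powr (1 - n))"
    if weight: "weak_homogeneous_weight N w" and N: "0 < N" and t: "0 < t" and z: "z \<noteq> 0" for w N t and z :: 'a
  proof -
    from weight have [measurable]: "w \<in> borel_measurable borel" and w: "\<And>y. 0 \<le> w y"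
      and hom: "\<And>r y. 0 < r \<Longrightarrow> y \<noteq> 0 \<Longrightarrow> w (r *\<^sub>R y) = w y"
      and weak: "\<And>s. 0 < s \<Longrightarrow> emeasure lborel ({y. s < w y} \<inter> ball 0 1) \<le> ennreal ((s / N) powr - n)"
      by (auto simp: weak_homogeneous_weight_def n_def)
    let ?u = "\<lambda>y. w y / N"
    have scaled: "(\<integral>\<^sup>+y. indicator (ball 0 1) y * ennreal (?u y * norm (y - z /\<^sub>R t) powr (1 - n)) \<partial>lborel)
        \<le> ennreal (C * norm (z /\<^sub>R t) powr (1 - n))"
    proof (rule unit)
      have "emeasure lborel ({y. s < ?u y} \<inter> ball 0 1) \<le> ennreal (s powr - n)" if "0 < s" for s
        using weak[of "s * N"] that N by (simp add: less_divide_eq)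
      then show "weak_homogeneous_weight 1 ?u"
        using w hom N by (simp add: weak_homogeneous_weight_def n_def divide_nonneg_pos)
    qed (use z t in auto)
    have "(\<integral>\<^sup>+y. indicator (ball 0 t) y * ennreal (w y * norm (y - z) powr (1 - n)) \<partial>lborel)
        = ennreal (t ^ DIM('a)) *
          (\<integral>\<^sup>+y. indicator (ball 0 t) (t *\<^sub>R y) * ennreal (w (t *\<^sub>R y) * norm (t *\<^sub>R y - z) powr (1 - n)) \<partial>lborel)"
      using t by (subst nn_integral_lborel_affine[of _ t 0]) simp_all
    also have "(\<integral>\<^sup>+y. indicator (ball 0 t) (t *\<^sub>R y) * ennreal (w (t *\<^sub>R y) * norm (t *\<^sub>R y - z) powr (1 - n)) \<partial>lborel)
        = (\<integral>\<^sup>+y. ennreal (N * t powr (1 - n)) *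
            (indicator (ball 0 1) y * ennreal (?u y * norm (y - z /\<^sub>R t) powr (1 - n))) \<partial>lborel)"
    proof (rule nn_integral_cong_AE)
      show "AE y in lborel. indicator (ball 0 t) (t *\<^sub>R y) * ennreal (w (t *\<^sub>R y) * norm (t *\<^sub>R y - z) powr (1 - n))
        = ennreal (N * t powr (1 - n)) * (indicator (ball 0 1) y * ennreal (?u y * norm (y - z /\<^sub>R t) powr (1 - n)))"
        using AE_lborel_singleton[of 0]
      proof eventually_elim
        case (elim y)
        have "t *\<^sub>R y - z = t *\<^sub>R (y - z /\<^sub>R t)"
          using t by (simp add: scaleR_diff_right)
        then have "norm (t *\<^sub>R y - z) powr (1 - n) = t powr (1 - n) * norm (y - z /\<^sub>R t) powr (1 - n)"
          using t by (simp add: powr_mult)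
        moreover have "t *\<^sub>R y \<in> ball 0 t \<longleftrightarrow> y \<in> ball 0 1"
          using t by simp
        ultimately show ?case
          using hom[OF t elim] N w by (auto simp: indicator_def mult_ac simp flip: ennreal_mult)
      qed
    qed
    also have "\<dots> = ennreal (N * t powr (1 - n)) *
        (\<integral>\<^sup>+y. indicator (ball 0 1) y * ennreal (?u y * norm (y - z /\<^sub>R t) powr (1 - n)) \<partial>lborel)"
      by (rule nn_integral_cmult) measurable
    also have "ennreal (t ^ DIM('a)) * \<dots>
        \<le> ennreal (t ^ DIM('a)) * (ennreal (N * t powr (1 - n)) * ennreal (C * norm (z /\<^sub>R t) powr (1 - n)))"
      by (intro mult_left_mono scaled) auto
    also have "norm (z /\<^sub>R t) powr (1 - n) = norm z powr (1 - n) * t powr (n - 1)"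
      using t powr_minus[of t "1 - n"] by (simp add: powr_mult inverse_powr powr_minus)
    also have "ennreal (t ^ DIM('a)) *
        (ennreal (N * t powr (1 - n)) * ennreal (C * (norm z powr (1 - n) * t powr (n - 1))))
        = ennreal (C * N * t ^ DIM('a) * norm z powr (1 - n) * (t powr (1 - n) * t powr (n - 1)))"
      using t C N by (simp add: mult_ac flip: ennreal_mult)
    also have "t powr (1 - n) * t powr (n - 1) = 1"
      using t by (simp flip: powr_add)
    finally show ?thesis by simp
  qed
  then show ?thesis
    using C by (intro exI[of _ C]) (simp add: n_def)
qed

section \<open>Domination by the Riesz potential of the gradient\<close>

text \<open>
  The fundamental theorem of calculus along the ray from \<open>y\<close> in direction \<open>v\<close>, up to a point outside
  the support.
\<close>

lemma norm_le_nn_integral_ray: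
  fixes f :: "'a::euclidean_space \<Rightarrow> 'b::banach"
  assumes deriv: "\<And>x. (f has_derivative f' x) (at x)"
    and bound: "\<And>x v. norm (f' x v) \<le> G x * norm v"
    and G: "continuous_on UNIV G" "\<And>x. 0 \<le> G x"
    and support: "\<And>x. R \<le> norm x \<Longrightarrow> f x = 0"
    and v: "1 \<le> norm v"
  shows "ennreal (norm (f y)) \<le> (\<integral>\<^sup>+s. indicator {0<..} s * ennreal (G (y + s *\<^sub>R v) * norm v) \<partial>lborel)"
proof -
  define T where "T = norm y + max R 0"
  have T: "0 \<le> T"
    by (simp add: T_def)
  have "T * 1 \<le> T * norm v"
    using v T by (rule mult_left_mono)
  then have "R \<le> norm (y + T *\<^sub>R v)"
    using norm_triangle_ineq2[of "T *\<^sub>R v" "- y"] T by (simp add: T_def add.commute)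
  then have end_zero: "f (y + T *\<^sub>R v) = 0"
    by (rule support)
  have "((\<lambda>s. f' (y + s *\<^sub>R v) v) has_integral (f (y + T *\<^sub>R v) - f (y + 0 *\<^sub>R v))) {0..T}"
  proof (rule fundamental_theorem_of_calculus[OF T])
    fix s :: real
    have "((\<lambda>s. f (y + s *\<^sub>R v)) has_derivative (\<lambda>h. f' (y + s *\<^sub>R v) (h *\<^sub>R v))) (at s within {0..T})"
      by (rule has_derivative_compose[OF _ deriv, unfolded o_def]) (auto intro!: derivative_eq_intros)
    moreover have "f' (y + s *\<^sub>R v) (h *\<^sub>R v) = h *\<^sub>R f' (y + s *\<^sub>R v) v" for h
      using has_derivative_linear[OF deriv] by (rule linear_scale)
    ultimately show "((\<lambda>s. f (y + s *\<^sub>R v)) has_vector_derivative f' (y + s *\<^sub>R v) v) (at s within {0..T})"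
      by (simp add: has_vector_derivative_def)
  qed
  then have ftc: "((\<lambda>s. f' (y + s *\<^sub>R v) v) has_integral - f y) {0..T}"
    by (simp add: end_zero)
  have "continuous_on {0..T} (\<lambda>s. G (y + s *\<^sub>R v) * norm v)"
    by (intro continuous_intros continuous_on_compose2[OF G(1)]) auto
  then have int: "(\<lambda>s. G (y + s *\<^sub>R v) * norm v) integrable_on {0..T}"
    by (rule integrable_continuous_real)
  have "norm (f y) = norm (integral {0..T} (\<lambda>s. f' (y + s *\<^sub>R v) v))"
    using ftc by (simp add: integral_unique)
  also have "\<dots> \<le> integral {0..T} (\<lambda>s. G (y + s *\<^sub>R v) * norm v)"
    using ftc int bound by (intro integral_norm_bound_integral) auto
  finally have "ennreal (norm (f y)) \<le> ennreal (integral {0..T} (\<lambda>s. G (y + s *\<^sub>R v) * norm v))"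
    by (rule ennreal_leI)
  also have "\<dots> = (\<integral>\<^sup>+s. ennreal (G (y + s *\<^sub>R v) * norm v) * indicator {0..T} s \<partial>lborel)"
    by (intro nn_integral_has_integral_lebesgue'[symmetric] integrable_integral[OF int]
          mult_nonneg_nonneg G norm_ge_zero)
  also have "\<dots> \<le> (\<integral>\<^sup>+s. indicator {0<..} s * ennreal (G (y + s *\<^sub>R v) * norm v) \<partial>lborel)"
    using AE_lborel_singleton[of "0::real"]
    by (intro nn_integral_mono_AE) (auto elim!: eventually_mono simp: indicator_def)
  finally show ?thesis .
qed

text \<open>
  For a given point \<open>u\<close>, the scales \<open>s\<close> with \<open>1 \<le> |u/s| < 2\<close> lie between \<open>|u|/2\<close> and \<open>|u|\<close>, so
  integrating a power of \<open>1/s\<close> over them costs one factor \<open>|u|\<close>.  This is how averaging over rays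
  produces the kernel \<open>|u|\<^bsup>1-n\<^esup>\<close>.
\<close>

lemma nn_integral_annulus_scales_le:
  fixes u :: "'a::euclidean_space" and a :: real
  assumes "0 \<le> a"
  shows "(\<integral>\<^sup>+s. indicator {0<..} s * (indicator (ball 0 2 - ball 0 1) (u /\<^sub>R s) *
           ennreal (a * (norm u / s) * (1 / s) ^ DIM('a))) \<partial>lborel)
      \<le> ennreal (2 ^ DIM('a)) * ennreal (a * norm u powr (1 - real DIM('a)))"
proof (cases "u = 0")
  case True
  then have "(\<lambda>s. indicator {0<..} s * (indicator (ball 0 2 - ball 0 1) (u /\<^sub>R s) *
           ennreal (a * (norm u / s) * (1 / s) ^ DIM('a)))) = (\<lambda>s::real. 0)"
    by (auto simp: fun_eq_iff indicator_def)
  then show ?thesis by simp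
next
  case False
  define d where "d = norm u"
  have d: "0 < d" using False by (simp add: d_def)
  have "(\<integral>\<^sup>+s. indicator {0<..} s * (indicator (ball 0 2 - ball 0 1) (u /\<^sub>R s) *
           ennreal (a * (d / s) * (1 / s) ^ DIM('a))) \<partial>lborel)
      \<le> (\<integral>\<^sup>+s. ennreal (a * (d * (2 / d)) * (2 / d) ^ DIM('a)) * indicator {d / 2..d} s \<partial>lborel)"
  proof (rule nn_integral_mono)
    fix s :: real
    show "indicator {0<..} s * (indicator (ball 0 2 - ball 0 1) (u /\<^sub>R s) *
           ennreal (a * (d / s) * (1 / s) ^ DIM('a)))
        \<le> ennreal (a * (d * (2 / d)) * (2 / d) ^ DIM('a)) * indicator {d / 2..d} s"
    proof (cases "0 < s \<and> u /\<^sub>R s \<in> ball 0 2 - ball 0 1")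
      case True
      then have s: "0 < s" "d / 2 \<le> s" "s \<le> d"
        by (auto simp: d_def field_simps)
      then have "1 / s \<le> 2 / d"
        using d by (simp add: field_simps)
      then have "a * (d * (1 / s)) * (1 / s) ^ DIM('a) \<le> a * (d * (2 / d)) * (2 / d) ^ DIM('a)"
        using s d assms by (intro mult_mono power_mono) auto
      then show ?thesis
        using s by (simp add: indicator_def ennreal_leI)
    qed (auto simp: indicator_def)
  qed
  also have "\<dots> = ennreal (a * (d * (2 / d)) * (2 / d) ^ DIM('a)) * ennreal (d / 2)"
    using d by (simp add: nn_integral_cmult)
  also have "\<dots> = ennreal (2 ^ DIM('a)) * ennreal (a * (d * (1 / d ^ DIM('a))))"
    using d assms by (simp add: power_divide field_simps flip: ennreal_mult)
  also have "d * (1 / d ^ DIM('a)) = d powr (1 - real DIM('a))"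
    using d by (simp add: powr_diff powr_realpow)
  finally show ?thesis
    by (simp add: d_def)
qed

text \<open>
  Average the estimate along rays over all directions \<open>v\<close> in an annulus rather than in the sphere.  The
  variables \<open>(s, v)\<close> then parametrise the points \<open>z = y + s v\<close> redundantly, which replaces polar
  coordinates by Tonelli's theorem and the substitution \<open>v = (z - y)/s\<close> for fixed \<open>s\<close>.  The measure of
  the annulus, on the left, is positive and finite.
\<close>

lemma norm_le_nn_integral_gradient:
  fixes f :: "'a::euclidean_space \<Rightarrow> 'b::banach"
  assumes deriv: "\<And>x. (f has_derivative f' x) (at x)"
    and bound: "\<And>x v. norm (f' x v) \<le> G x * norm v"
    and G: "continuous_on UNIV G" "\<And>x. 0 \<le> G x"
    and support: "\<And>x. R \<le> norm x \<Longrightarrow> f x = 0"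
  shows "ennreal (norm (f y)) * emeasure lborel (ball 0 2 - ball 0 1 :: 'a set)
      \<le> ennreal (2 ^ DIM('a)) * (\<integral>\<^sup>+z. ennreal (G z * norm (z - y) powr (1 - real DIM('a))) \<partial>lborel)"
proof -
  let ?A = "ball 0 2 - ball 0 1 :: 'a set"
  have [measurable]: "G \<in> borel_measurable borel"
    using G(1) by (rule borel_measurable_continuous_onI)
  have "ennreal (norm (f y)) * emeasure lborel ?A = (\<integral>\<^sup>+v. ennreal (norm (f y)) * indicator ?A v \<partial>lborel)"
    by (simp add: nn_integral_cmult)
  also have "\<dots> \<le> (\<integral>\<^sup>+v. \<integral>\<^sup>+s. indicator {0<..} s * (indicator ?A v * ennreal (G (y + s *\<^sub>R v) * norm v)) \<partial>lborel \<partial>lborel)"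
  proof (rule nn_integral_mono)
    fix v :: 'a
    show "ennreal (norm (f y)) * indicator ?A v
      \<le> (\<integral>\<^sup>+s. indicator {0<..} s * (indicator ?A v * ennreal (G (y + s *\<^sub>R v) * norm v)) \<partial>lborel)"
    proof (cases "v \<in> ?A")
      case True
      then have "1 \<le> norm v" by simp
      from norm_le_nn_integral_ray[OF deriv bound G support this, where y = y] True show ?thesis
        by simp
    qed simp
  qed
  also have "\<dots> = (\<integral>\<^sup>+s. \<integral>\<^sup>+v. indicator {0<..} s * (indicator ?A v * ennreal (G (y + s *\<^sub>R v) * norm v)) \<partial>lborel \<partial>lborel)"
    by (rule lborel_pair.Fubini') measurable
  also have "\<dots> = (\<integral>\<^sup>+s. \<integral>\<^sup>+z. indicator {0<..} s * (indicator ?A ((z - y) /\<^sub>R s) *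
      ennreal (G z * (norm (z - y) / s) * (1 / s) ^ DIM('a))) \<partial>lborel \<partial>lborel)"
  proof (rule nn_integral_cong)
    fix s :: real
    show "(\<integral>\<^sup>+v. indicator {0<..} s * (indicator ?A v * ennreal (G (y + s *\<^sub>R v) * norm v)) \<partial>lborel)
      = (\<integral>\<^sup>+z. indicator {0<..} s * (indicator ?A ((z - y) /\<^sub>R s) *
          ennreal (G z * (norm (z - y) / s) * (1 / s) ^ DIM('a))) \<partial>lborel)"
    proof (cases "0 < s")
      case s: True
      have "(\<integral>\<^sup>+z. indicator {0<..} s * (indicator ?A ((z - y) /\<^sub>R s) *
          ennreal (G z * (norm (z - y) / s) * (1 / s) ^ DIM('a))) \<partial>lborel)
        = ennreal (s ^ DIM('a)) * (\<integral>\<^sup>+v. indicator ?A v *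
          ennreal (G (y + s *\<^sub>R v) * norm v * (1 / s) ^ DIM('a)) \<partial>lborel)"
        using s by (subst nn_integral_lborel_affine[of _ s y]) simp_all
      also have "\<dots> = (\<integral>\<^sup>+v. ennreal (s ^ DIM('a)) * (indicator ?A v *
          ennreal (G (y + s *\<^sub>R v) * norm v * (1 / s) ^ DIM('a))) \<partial>lborel)"
        by (rule nn_integral_cmult[symmetric]) measurable
      also have "\<dots> = (\<integral>\<^sup>+v. indicator {0<..} s * (indicator ?A v * ennreal (G (y + s *\<^sub>R v) * norm v)) \<partial>lborel)"
        using s G(2) by (intro nn_integral_cong) (simp add: indicator_def power_one_over flip: ennreal_mult)
      finally show ?thesis by simp
    qed simp
  qed
  also have "\<dots> = (\<integral>\<^sup>+z. \<integral>\<^sup>+s. indicator {0<..} s * (indicator ?A ((z - y) /\<^sub>R s) *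
      ennreal (G z * (norm (z - y) / s) * (1 / s) ^ DIM('a))) \<partial>lborel \<partial>lborel)"
    by (rule lborel_pair.Fubini') measurable
  also have "\<dots> \<le> (\<integral>\<^sup>+z. ennreal (2 ^ DIM('a)) * ennreal (G z * norm (z - y) powr (1 - real DIM('a))) \<partial>lborel)"
    by (intro nn_integral_mono nn_integral_annulus_scales_le G)
  also have "\<dots> = ennreal (2 ^ DIM('a)) * (\<integral>\<^sup>+z. ennreal (G z * norm (z - y) powr (1 - real DIM('a))) \<partial>lborel)"
    by (rule nn_integral_cmult) measurable
  finally show ?thesis .
qed

text \<open>
  Tonelli's theorem transfers a bound for the weight integrated against the Riesz kernel to the weight
  integrated against \<open>f\<close>: the inner integral over \<open>y\<close> has the kernel \<open>|z - (x - y)| = |y - (x - z)|\<close>.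
\<close>

lemma nn_integral_weight_times_le:
  fixes f :: "'a::euclidean_space \<Rightarrow> 'b::banach" and w :: "'a \<Rightarrow> real"
  assumes [measurable]: "w \<in> borel_measurable borel" and w: "\<And>y. 0 \<le> w y"
    and kernel: "\<And>z. z \<noteq> 0 \<Longrightarrow>
      (\<integral>\<^sup>+y. indicator B y * ennreal (w y * norm (y - z) powr (1 - real DIM('a))) \<partial>lborel)
        \<le> ennreal (K * norm z powr (1 - real DIM('a)))"
    and K: "0 \<le> K" and [measurable]: "B \<in> sets borel"
    and deriv: "\<And>x. (f has_derivative f' x) (at x)"
    and bound: "\<And>x v. norm (f' x v) \<le> G x * norm v"
    and G: "continuous_on UNIV G" "\<And>x. 0 \<le> G x"
    and support: "\<And>x. R \<le> norm x \<Longrightarrow> f x = 0"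
  shows "(\<integral>\<^sup>+y. indicator B y * ennreal (w y * norm (f (x - y))) \<partial>lborel) * emeasure lborel (ball 0 2 - ball 0 1 :: 'a set)
      \<le> ennreal (2 ^ DIM('a) * K) * (\<integral>\<^sup>+z. ennreal (G z * norm (x - z) powr (1 - real DIM('a))) \<partial>lborel)"
proof -
  define p where "p = 1 - real DIM('a)"
  define a where "a = emeasure lborel (ball 0 2 - ball 0 1 :: 'a set)"
  have [measurable]: "G \<in> borel_measurable borel"
    using G(1) by (rule borel_measurable_continuous_onI)
  have "continuous_on UNIV f"
    by (meson deriv differentiable_def differentiable_imp_continuous_within continuous_at_imp_continuous_on)
  then have "continuous_on UNIV (\<lambda>x. norm (f x))"
    by (rule continuous_on_norm)
  then have [measurable]: "(\<lambda>x. norm (f x)) \<in> borel_measurable borel"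
    by (rule borel_measurable_continuous_onI)
  have [measurable]: "(\<lambda>y. norm (f (x - y))) \<in> borel_measurable borel"
    by (rule measurable_compose[of "\<lambda>y. x - y" borel borel "\<lambda>x. norm (f x)"]) measurable
  have "(\<integral>\<^sup>+y. indicator B y * ennreal (w y * norm (f (x - y))) \<partial>lborel) * a
      = (\<integral>\<^sup>+y. indicator B y * ennreal (w y) * (ennreal (norm (f (x - y))) * a) \<partial>lborel)"
    using w by (simp add: ennreal_mult mult.assoc flip: nn_integral_multc)
  also have "\<dots> \<le> (\<integral>\<^sup>+y. indicator B y * ennreal (w y) *
      (ennreal (2 ^ DIM('a)) * (\<integral>\<^sup>+z. ennreal (G z * norm (z - (x - y)) powr p) \<partial>lborel)) \<partial>lborel)"
    unfolding a_def p_def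
    by (intro nn_integral_mono mult_left_mono norm_le_nn_integral_gradient[OF deriv bound G support]) auto
  also have "\<dots> = (\<integral>\<^sup>+y. \<integral>\<^sup>+z. indicator B y * ennreal (w y) *
      (ennreal (2 ^ DIM('a)) * ennreal (G z * norm (z - (x - y)) powr p)) \<partial>lborel \<partial>lborel)"
    by (simp add: nn_integral_cmult)
  also have "\<dots> = (\<integral>\<^sup>+z. \<integral>\<^sup>+y. indicator B y * ennreal (w y) *
      (ennreal (2 ^ DIM('a)) * ennreal (G z * norm (z - (x - y)) powr p)) \<partial>lborel \<partial>lborel)"
    by (rule lborel_pair.Fubini') measurable
  also have "\<dots> = (\<integral>\<^sup>+z. ennreal (2 ^ DIM('a) * G z) *
      (\<integral>\<^sup>+y. indicator B y * ennreal (w y * norm (y - (x - z)) powr p) \<partial>lborel) \<partial>lborel)"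
  proof (rule nn_integral_cong)
    fix z
    have "indicator B y * ennreal (w y) * (ennreal (2 ^ DIM('a)) * ennreal (G z * norm (z - (x - y)) powr p))
        = ennreal (2 ^ DIM('a) * G z) * (indicator B y * ennreal (w y * norm (y - (x - z)) powr p))" for y
      using w G(2) by (simp add: ennreal_mult mult_ac algebra_simps)
    then show "(\<integral>\<^sup>+y. indicator B y * ennreal (w y) *
        (ennreal (2 ^ DIM('a)) * ennreal (G z * norm (z - (x - y)) powr p)) \<partial>lborel)
      = ennreal (2 ^ DIM('a) * G z) * (\<integral>\<^sup>+y. indicator B y * ennreal (w y * norm (y - (x - z)) powr p) \<partial>lborel)"
      by (simp add: nn_integral_cmult)
  qed
  also have "\<dots> \<le> (\<integral>\<^sup>+z. ennreal (2 ^ DIM('a) * G z) * ennreal (K * norm (x - z) powr p) \<partial>lborel)"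
    using AE_lborel_singleton[of x] unfolding p_def
    by (intro nn_integral_mono_AE) (auto elim!: eventually_mono intro!: mult_left_mono kernel)
  also have "\<dots> = (\<integral>\<^sup>+z. ennreal (2 ^ DIM('a) * K) * ennreal (G z * norm (x - z) powr p) \<partial>lborel)"
    using K G(2) by (intro nn_integral_cong) (simp add: mult_ac flip: ennreal_mult)
  also have "\<dots> = ennreal (2 ^ DIM('a) * K) * (\<integral>\<^sup>+z. ennreal (G z * norm (x - z) powr p) \<partial>lborel)"
    by (rule nn_integral_cmult) measurable
  finally show ?thesis
    by (simp add: a_def p_def)
qed

section \<open>From the sphere to homogeneous weights\<close>

abbreviation radial_projection :: "'a::real_normed_vector \<Rightarrow> 'a" where
  "radial_projection x \<equiv> x /\<^sub>R norm x"

lemma measurable_radial_projection: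
  "(radial_projection :: 'a::euclidean_space \<Rightarrow> 'a) \<in> restrict_space borel (- {0}) \<rightarrow>\<^sub>M restrict_space borel (sphere 0 1)"
  by (rule measurable_restrict_space3) auto

lemma radial_projection_scaleR: "0 < r \<Longrightarrow> radial_projection (r *\<^sub>R x) = radial_projection x"
  by simp

lemma cone_in_borel:
  fixes A :: "'a::euclidean_space set"
  assumes A: "A \<in> sets (restrict_space borel (sphere 0 1))"
  shows "{x. x \<noteq> 0 \<and> radial_projection x \<in> A} \<in> sets borel"
proof -
  have "radial_projection -` A \<inter> space (restrict_space borel (- {0})) \<in> sets (restrict_space borel (- {0} :: 'a set))"
    using measurable_radial_projection A by (rule measurable_sets)
  then have "radial_projection -` A \<inter> - {0} \<in> sets borel"
    by (subst (asm) sets_restrict_space_iff) (auto simp: space_restrict_space)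
  then show ?thesis
    by (rule back_subst) auto
qed

definition borel_sphere_measure :: "(real ^ 'n) measure" where
  "borel_sphere_measure = scale_measure (of_nat CARD('n))
     (distr (restrict_space lborel (cball 0 1 - {0})) (restrict_space borel (sphere 0 1)) radial_projection)"

lemma sphere_measure_eq_completion: "sphere_measure = completion borel_sphere_measure"
  by (simp add: sphere_measure_def borel_sphere_measure_def)

lemma sets_borel_sphere_measure [measurable_cong]:
  "sets (borel_sphere_measure :: (real ^ 'n) measure) = sets (restrict_space borel (sphere 0 1))"
  by (simp add: borel_sphere_measure_def)

lemma space_borel_sphere_measure: "space (borel_sphere_measure :: (real ^ 'n) measure) = sphere 0 1"
  using sets_eq_imp_space_eq[OF sets_borel_sphere_measure] by (simp add: space_restrict_space)

lemma emeasure_borel_sphere_measure: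
  fixes A :: "(real ^ 'n) set"
  assumes A: "A \<in> sets (restrict_space borel (sphere 0 1))"
  shows "emeasure borel_sphere_measure A
    = of_nat CARD('n) * emeasure lborel {x \<in> cball 0 1 - {0}. radial_projection x \<in> A}"
proof -
  have meas: "(radial_projection :: real ^ 'n \<Rightarrow> _)
      \<in> restrict_space lborel (cball 0 1 - {0}) \<rightarrow>\<^sub>M restrict_space borel (sphere 0 1)"
    by (rule measurable_restrict_space3) auto
  have "emeasure borel_sphere_measure A = of_nat CARD('n) * emeasure (restrict_space lborel (cball 0 1 - {0}))
      (radial_projection -` A \<inter> space (restrict_space lborel (cball 0 1 - {0})))"
    using A meas by (simp add: borel_sphere_measure_def emeasure_distr)
  also have "radial_projection -` A \<inter> space (restrict_space lborel (cball 0 1 - {0}))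
      = {x \<in> cball 0 1 - {0}. radial_projection x \<in> A}"
    by (auto simp: space_restrict_space)
  also have "emeasure (restrict_space lborel (cball 0 1 - {0})) {x \<in> cball 0 1 - {0}. radial_projection x \<in> A}
      = emeasure lborel {x \<in> cball 0 1 - {0}. radial_projection x \<in> A}"
    by (rule emeasure_restrict_space) auto
  finally show ?thesis .
qed

text \<open>
  The inequality loses the factor \<open>n\<close> of the surface measure, which the constant of the theorem absorbs.
\<close>

lemma emeasure_cone_le_borel_sphere_measure:
  fixes A :: "(real ^ 'n) set"
  assumes A: "A \<in> sets (restrict_space borel (sphere 0 1))"
    and E: "\<And>x. x \<in> E \<Longrightarrow> x \<noteq> 0 \<and> radial_projection x \<in> A"
  shows "emeasure lborel (E \<inter> ball 0 1) \<le> emeasure borel_sphere_measure A"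
proof -
  have "{x. x \<noteq> 0 \<and> radial_projection x \<in> A} \<inter> cball 0 1 \<in> sets lborel"
    using cone_in_borel[OF A] by auto
  then have "{x \<in> cball 0 1 - {0}. radial_projection x \<in> A} \<in> sets lborel"
    by (rule back_subst) auto
  then have "emeasure lborel (E \<inter> ball 0 1) \<le> emeasure lborel {x \<in> cball 0 1 - {0}. radial_projection x \<in> A}"
    using E by (intro emeasure_mono) auto
  also have "\<dots> = 1 * \<dots>"
    by simp
  also have "\<dots> \<le> of_nat CARD('n) * emeasure lborel {x \<in> cball 0 1 - {0}. radial_projection x \<in> A}"
    by (rule mult_right_mono) (auto simp: Suc_leI)
  finally show ?thesis
    by (simp add: emeasure_borel_sphere_measure[OF A])
qed

text \<open>
  The surface measure only sees the part of the cone in the unit ball; by scaling, its part in each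
  larger ball is null as well.
\<close>

lemma null_set_cone:
  fixes Z :: "(real ^ 'n) set"
  assumes Z: "Z \<in> null_sets borel_sphere_measure"
  shows "{y. y \<noteq> 0 \<and> radial_projection y \<in> Z} \<in> null_sets lborel"
proof -
  let ?E = "{y. y \<noteq> 0 \<and> radial_projection y \<in> Z}"
  have sets_Z: "Z \<in> sets (restrict_space borel (sphere 0 1))"
    using Z by (auto simp: sets_borel_sphere_measure)
  then have [measurable]: "?E \<in> sets borel"
    by (rule cone_in_borel)
  have "emeasure lborel (?E \<inter> ball 0 1) \<le> emeasure borel_sphere_measure Z"
    using sets_Z by (rule emeasure_cone_le_borel_sphere_measure) auto
  then have unit: "emeasure lborel (?E \<inter> ball 0 1) = 0"
    using Z by (simp add: null_sets_def)
  have "emeasure lborel (?E \<inter> ball 0 r) = 0" if "0 \<le> r" for r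
  proof -
    have "emeasure lborel (?E \<inter> ball 0 r)
        = ennreal (r ^ DIM(real ^ 'n)) * emeasure lborel (?E \<inter> ball 0 1)"
      by (rule emeasure_cone_ball)
        (use that in \<open>auto simp: radial_projection_scaleR simp del: norm_scaleR scaleR_scaleR\<close>)
    then show ?thesis
      using unit by simp
  qed
  moreover have "?E \<inter> ball 0 r \<in> sets lborel" for r
    by simp
  ultimately have "?E \<inter> ball 0 (real k) \<in> null_sets lborel" for k :: nat
    by (intro null_setsI) auto
  then have "(\<Union>k. ?E \<inter> ball 0 (real k)) \<in> null_sets lborel"
    by (rule null_sets_UN)
  also have "(\<Union>k. ?E \<inter> ball 0 (real k)) = ?E"
    by (auto simp: reals_Archimedean2)
  finally show ?thesis .
qed

lemma measure_superlevel_le_weak_Ln: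
  fixes \<Omega> :: "real ^ 'n \<Rightarrow> complex"
  assumes "weak_Ln_norm \<Omega> \<le> ennreal N" "0 < N" "0 < s"
  shows "measure (sphere_measure :: (real ^ 'n) measure) {\<theta>\<in>sphere 0 1. norm (\<Omega> \<theta>) > s}
      \<le> (s / N) powr - real CARD('n)"
proof -
  let ?m = "measure (sphere_measure :: (real ^ 'n) measure) {\<theta>\<in>sphere 0 1. norm (\<Omega> \<theta>) > s}"
  have "ennreal (s * ?m powr (1 / real CARD('n))) \<le> weak_Ln_norm \<Omega>"
    unfolding weak_Ln_norm_def using assms by (intro SUP_upper) auto
  then have "ennreal (s * ?m powr (1 / real CARD('n))) \<le> ennreal N"
    using assms(1) by (rule order_trans)
  then have "?m powr (1 / real CARD('n)) \<le> N / s"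
    using assms by (simp add: field_simps)
  then have "(?m powr (1 / real CARD('n))) powr real CARD('n) \<le> (N / s) powr real CARD('n)"
    by (intro powr_mono2) auto
  also have "(?m powr (1 / real CARD('n))) powr real CARD('n) = ?m"
    by (simp add: powr_powr)
  also have "(N / s) powr real CARD('n) = (s / N) powr - real CARD('n)"
    using assms inverse_powr_eq_powr_minus[of "s / N" "real CARD('n)"] by simp
  finally show ?thesis .
qed

text \<open>
  Measurability with respect to the completed surface measure provides a Borel function \<open>h\<close> on the sphere
  that agrees with \<open>|\<Omega>|\<close> almost everywhere; its homogeneous extension agrees with \<open>|\<Omega>|\<close> almost everywhere
  on \<open>\<real>\<^sup>n\<close> because cones over null sets are null.
\<close>

lemma ex_weak_homogeneous_weight:
  fixes \<Omega> :: "real ^ 'n \<Rightarrow> complex"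
  assumes hom: "homogeneous_deg0 \<Omega>" and meas: "\<Omega> \<in> borel_measurable sphere_measure"
    and N: "weak_Ln_norm \<Omega> \<le> ennreal N" "0 < N"
  shows "\<exists>w. weak_homogeneous_weight N w \<and> (AE y in lborel. norm (\<Omega> y) = w y)"
proof -
  have meas_norm: "(\<lambda>\<theta>. norm (\<Omega> \<theta>)) \<in> borel_measurable (completion borel_sphere_measure)"
    using meas unfolding sphere_measure_eq_completion by (rule measurable_compose[OF _ borel_measurable_norm])
  from completion_ex_borel_measurable_real[OF this]
  obtain h where h: "h \<in> borel_measurable borel_sphere_measure"
    and ae: "AE \<theta> in borel_sphere_measure. norm (\<Omega> \<theta>) = h \<theta>"
    by blast
  from h have h': "h \<in> borel_measurable (restrict_space borel (sphere 0 1))"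
    by (simp add: measurable_cong_sets[OF sets_borel_sphere_measure refl])
  define w where "w y = (if y = 0 then 0 else max 0 (h (radial_projection y)))" for y
  have "(\<lambda>y. max 0 (h (radial_projection y))) \<in> borel_measurable (restrict_space borel (- {0}))"
    by (intro borel_measurable_max borel_measurable_const measurable_compose[OF measurable_radial_projection h'])
  then have w_meas: "w \<in> borel_measurable borel"
    unfolding w_def by (subst measurable_If_restrict_space_iff) (auto simp: Compl_eq)
  have w_nonneg: "0 \<le> w y" for y
    by (simp add: w_def)
  have w_hom: "w (r *\<^sub>R y) = w y" if "0 < r" for r y
    using that radial_projection_scaleR[OF that, of y] by (simp add: w_def del: norm_scaleR scaleR_scaleR)
  have tail: "emeasure lborel ({y. s < w y} \<inter> ball 0 1) \<le> ennreal ((s / N) powr - real DIM(real ^ 'n))"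
    if s: "0 < s" for s
  proof -
    let ?H = "{\<theta> \<in> space borel_sphere_measure. s < h \<theta>}" and ?L = "{\<theta>\<in>sphere 0 1. norm (\<Omega> \<theta>) > s}"
    have H: "?H \<in> sets borel_sphere_measure"
      using h by measurable
    have L: "?L \<in> sets (completion borel_sphere_measure)"
    proof -
      have "{\<theta> \<in> space (completion borel_sphere_measure). s < norm (\<Omega> \<theta>)} \<in> sets (completion borel_sphere_measure)"
        using meas_norm by measurable
      then show ?thesis
        by (simp add: space_borel_sphere_measure)
    qed
    have "emeasure lborel ({y. s < w y} \<inter> ball 0 1) \<le> emeasure borel_sphere_measure ?H"
      using H s by (intro emeasure_cone_le_borel_sphere_measure)
        (auto simp: sets_borel_sphere_measure space_borel_sphere_measure w_def split: if_splits)
    also have "\<dots> = emeasure (completion borel_sphere_measure) ?H"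
      using H by simp
    also have "\<dots> = emeasure (completion borel_sphere_measure) ?L"
    proof (rule emeasure_eq_AE)
      show "AE \<theta> in completion borel_sphere_measure. \<theta> \<in> ?H \<longleftrightarrow> \<theta> \<in> ?L"
        using AE_completion[OF ae] by eventually_elim (simp add: space_borel_sphere_measure)
    qed (use H L in \<open>simp_all add: sets_completionI_sets\<close>)
    also have "\<dots> = ennreal (measure sphere_measure ?L)"
    proof -
      have "emeasure (completion borel_sphere_measure) ?L \<le> emeasure (completion borel_sphere_measure) (sphere 0 1 :: (real ^ 'n) set)"
        using sets.top[of "completion (borel_sphere_measure :: (real ^ 'n) measure)"]
        by (intro emeasure_mono) (auto simp: space_borel_sphere_measure)
      also have "\<dots> = emeasure borel_sphere_measure (sphere 0 1 :: (real ^ 'n) set)"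
        using sets.top[of "borel_sphere_measure :: (real ^ 'n) measure"] by (simp add: space_borel_sphere_measure)
      also have "\<dots> \<le> of_nat CARD('n) * emeasure lborel (cball 0 1 :: (real ^ 'n) set)"
        by (subst emeasure_borel_sphere_measure)
          (auto simp: sets_restrict_space_iff intro!: mult_left_mono emeasure_mono)
      also have "\<dots> < \<infinity>"
        by (simp add: emeasure_cball ennreal_mult_less_top of_nat_less_top)
      finally show ?thesis
        unfolding sphere_measure_eq_completion by (simp add: emeasure_eq_ennreal_measure)
    qed
    also have "\<dots> \<le> ennreal ((s / N) powr - real DIM(real ^ 'n))"
      using measure_superlevel_le_weak_Ln[OF N s] by (simp add: ennreal_leI)
    finally show ?thesis .
  qed
  from ae obtain Z where Z: "{\<theta> \<in> space borel_sphere_measure. norm (\<Omega> \<theta>) \<noteq> h \<theta>} \<subseteq> Z"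
    and Z_null: "Z \<in> null_sets borel_sphere_measure"
    by (auto elim!: AE_E3)
  from AE_not_in[OF null_set_cone[OF Z_null]] AE_lborel_singleton[of 0]
  have "AE y in lborel. norm (\<Omega> y) = w y"
  proof eventually_elim
    case (elim y)
    then have "radial_projection y \<in> space borel_sphere_measure" "radial_projection y \<notin> Z"
      by (auto simp: space_borel_sphere_measure)
    then have "norm (\<Omega> (radial_projection y)) = h (radial_projection y)"
      using Z by auto
    moreover have "\<Omega> (radial_projection y) = \<Omega> y"
      using hom elim by (simp add: homogeneous_deg0_def)
    ultimately have "h (radial_projection y) = norm (\<Omega> y)"
      by simp
    then show ?case
      using elim by (simp add: w_def)
  qed
  moreover have "weak_homogeneous_weight N w"
    using w_meas w_nonneg w_hom tail by (simp add: weak_homogeneous_weight_def)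
  ultimately show ?thesis by blast
qed

section \<open>The pointwise estimate for test functions\<close>

text \<open>
  The Bochner integral is \<open>0\<close> by convention for a function that is not integrable, so integrability has to
  be proved: \<open>g\<close> is bounded with bounded support, and the kernel is locally integrable.
\<close>

lemma riesz_potential1_eq_nn_integral:
  fixes g :: "real ^ 'n \<Rightarrow> real"
  assumes dim: "2 \<le> CARD('n)"
    and g: "continuous_on UNIV g" "\<And>z. 0 \<le> g z" and support: "\<And>z. R \<le> norm z \<Longrightarrow> g z = 0"
  shows "ennreal (riesz_potential1 g x) = (\<integral>\<^sup>+z. ennreal (g z * norm (x - z) powr (1 - real DIM(real ^ 'n))) \<partial>lborel)"
proof -
  let ?h = "\<lambda>z. g z * norm (x - z) powr (1 - real CARD('n))"
  have [measurable]: "g \<in> borel_measurable borel"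
    using g(1) by (rule borel_measurable_continuous_onI)
  have kernel: "g z / norm (x - z) ^ (CARD('n) - 1) = ?h z" for z
  proof (cases "z = x")
    case False
    then have "norm (x - z) powr (1 - real CARD('n)) = inverse (norm (x - z) powr real (CARD('n) - 1))"
      using dim by (simp add: of_nat_diff flip: powr_minus)
    then show ?thesis
      using False by (simp only: powr_realpow zero_less_norm_iff right_minus_eq not_sym divide_inverse)
  \<comment> \<open>At \<open>z = x\<close> both sides vanish: \<open>1/0 = 0\<close> as \<open>n - 1 > 0\<close>, and \<open>0 powr (1 - n) = 0\<close>.\<close>
  qed (use dim in simp)
  have "bounded (g ` cball 0 R)"
    by (intro compact_imp_bounded compact_continuous_image continuous_on_subset[OF g(1)]) auto
  then obtain B where B: "\<And>z. z \<in> cball 0 R \<Longrightarrow> norm (g z) \<le> B"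
    unfolding bounded_iff by blast
  obtain C where C: "(\<integral>\<^sup>+z. indicator (ball x (R + norm x)) z * ennreal (norm (z - x) powr - (real CARD('n) - 1)) \<partial>lborel) \<le> ennreal C"
    using ex_nn_integral_norm_powr_ball_bound[of "real CARD('n) - 1" "R + norm x", where 'a="real ^ 'n"] dim by auto
  have "(\<integral>\<^sup>+z. ennreal (?h z) \<partial>lborel) \<le> (\<integral>\<^sup>+z. ennreal (max B 0) * (indicator (ball x (R + norm x)) z *
      ennreal (norm (z - x) powr - (real CARD('n) - 1))) \<partial>lborel)"
  proof (rule nn_integral_mono)
    fix z
    show "ennreal (?h z) \<le> ennreal (max B 0) * (indicator (ball x (R + norm x)) z *
      ennreal (norm (z - x) powr - (real CARD('n) - 1)))"
    proof (cases "norm z < R")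
      case True
      then have "z \<in> ball x (R + norm x)"
        using norm_triangle_ineq4[of x z] by (simp add: dist_norm)
      moreover have "g z \<le> max B 0"
        using B[of z] True by auto
      ultimately show ?thesis
        by (simp add: norm_minus_commute ennreal_leI mult_right_mono flip: ennreal_mult)
    qed (simp add: support)
  qed
  also have "\<dots> = ennreal (max B 0) * (\<integral>\<^sup>+z. indicator (ball x (R + norm x)) z *
      ennreal (norm (z - x) powr - (real CARD('n) - 1)) \<partial>lborel)"
    by (rule nn_integral_cmult) measurable
  also have "\<dots> \<le> ennreal (max B 0) * ennreal C"
    by (intro mult_left_mono C) simp
  also have "\<dots> < \<infinity>"
    by (simp add: ennreal_mult_less_top)
  finally have fin: "(\<integral>\<^sup>+z. ennreal (?h z) \<partial>lebesgue) < \<infinity>"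
    by (simp add: nn_integral_completion)
  have "integrable lebesgue ?h"
  proof (rule integrableI_nonneg)
    have "?h \<in> borel_measurable lborel"
      by measurable
    then show "?h \<in> borel_measurable lebesgue"
      by (rule measurable_completion)
  qed (use fin g in auto)
  then have "(\<integral>\<^sup>+z. ennreal (?h z) \<partial>lebesgue) = ennreal (riesz_potential1 g x)"
    unfolding riesz_potential1_def kernel using g by (intro nn_integral_eq_integral) auto
  then show ?thesis
    by (simp add: nn_integral_completion)
qed

lemma test_function_has_derivative:
  assumes "test_function f"
  shows "(f has_derivative frechet_derivative f (at x)) (at x)"
proof -
  have "Ck 1 f"
    using assms by (simp add: test_function_def)
  then have "f differentiable at x"
    by (simp add: differentiable_on_def)
  then show ?thesis
    by (simp add: frechet_derivative_works)
qed

lemma continuous_on_norm_gradient: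
  assumes "test_function f"
  shows "continuous_on UNIV (\<lambda>x. norm (gradient f x))"
proof -
  have "Ck (Suc 0) f"
    using assms by (simp only: test_function_def)
  then show ?thesis
    unfolding gradient_def by (intro continuous_on_norm continuous_on_vec_lambda) simp
qed

lemma norm_frechet_derivative_le_gradient:
  assumes "test_function f"
  shows "norm (frechet_derivative f (at x) v) \<le> norm (gradient f x) * norm v"
proof -
  let ?D = "frechet_derivative f (at x)"
  have lin: "linear ?D"
    using test_function_has_derivative[OF assms] by (rule has_derivative_linear)
  have "?D v = ?D (\<Sum>i\<in>UNIV. v $ i *\<^sub>R axis i 1)"
    using basis_expansion[of v] by (simp add: scalar_mult_eq_scaleR)
  also have "\<dots> = (\<Sum>i\<in>UNIV. v $ i *\<^sub>R gradient f x $ i)"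
    by (simp add: linear_sum[OF lin] linear_scale[OF lin] gradient_def partial_deriv_def)
  also have "norm \<dots> \<le> (\<Sum>i\<in>UNIV. \<bar>norm (gradient f x $ i)\<bar> * \<bar>norm (v $ i)\<bar>)"
    by (rule sum_norm_le) simp
  also have "\<dots> \<le> norm (gradient f x) * norm v"
    unfolding norm_vec_def by (rule L2_set_mult_ineq)
  finally show ?thesis .
qed

lemma test_function_support:
  fixes f :: "real ^ 'n \<Rightarrow> complex"
  assumes "test_function f"
  obtains R where "\<And>x. R \<le> norm x \<Longrightarrow> f x = 0" "\<And>x. R \<le> norm x \<Longrightarrow> gradient f x = 0"
proof -
  define S where "S = closure {x. f x \<noteq> 0}"
  have "bounded S" "closed S"
    using assms by (simp_all add: test_function_def compact_imp_bounded S_def)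
  obtain R where R: "\<And>x. x \<in> S \<Longrightarrow> norm x < R"
    using \<open>bounded S\<close> unfolding bounded_pos_less by blast
  have outside: "f x = 0" if "x \<notin> S" for x
    using that closure_subset[of "{x. f x \<noteq> 0}"] by (auto simp: S_def)
  have "gradient f x = 0" if "R \<le> norm x" for x
  proof -
    have x: "x \<in> - S"
      using that R[of x] by auto
    have "(f has_derivative (\<lambda>_. 0)) (at x)"
      by (rule has_derivative_transform_within_open[OF has_derivative_const[of 0] _ x])
        (auto simp: outside \<open>closed S\<close>)
    then have "frechet_derivative f (at x) = (\<lambda>_. 0)"
      by (rule frechet_derivative_at[symmetric])
    then show ?thesis
      by (simp add: gradient_def partial_deriv_def vec_eq_iff)
  qed
  moreover have "f x = 0" if "R \<le> norm x" for x
    using that R[of x] outside[of x] by auto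
  ultimately show thesis
    using that by blast
qed

text \<open>
  The number \<open>N\<close> is a positive upper bound for the weak norm rather than the norm itself, since the scaling
  argument divides by it and the norm may be zero.
\<close>

lemma ex_rough_maximal_bound:
  assumes dim: "2 \<le> CARD('n)"
  shows "\<exists>C\<ge>0. \<forall>(\<Omega> :: real ^ 'n \<Rightarrow> complex) f x N.
    homogeneous_deg0 \<Omega> \<longrightarrow> \<Omega> \<in> borel_measurable sphere_measure \<longrightarrow> weak_Ln_norm \<Omega> \<le> ennreal N \<longrightarrow> 0 < N \<longrightarrow>
    test_function f \<longrightarrow>
    rough_maximal \<Omega> f x \<le> ennreal (C * N) * ennreal (riesz_potential1 (\<lambda>y. norm (gradient f y)) x)"
proof -
  let ?n = "DIM(real ^ 'n)"
  let ?A = "ball 0 2 - ball 0 1 :: (real ^ 'n) set"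
  obtain C where C: "0 \<le> C" and kernel: "\<And>w N t (z :: real ^ 'n).
    weak_homogeneous_weight N w \<Longrightarrow> 0 < N \<Longrightarrow> 0 < t \<Longrightarrow> z \<noteq> 0 \<Longrightarrow>
    (\<integral>\<^sup>+y. indicator (ball 0 t) y * ennreal (w y * norm (y - z) powr (1 - real ?n)) \<partial>lborel)
      \<le> ennreal (C * N * t ^ ?n * norm z powr (1 - real ?n))"
    using ex_cone_kernel_bound[where 'a="real ^ 'n"] dim by auto
  define a where "a = measure lborel ?A"
  have "emeasure lborel ?A = emeasure lborel (ball 0 2 :: (real ^ 'n) set) - emeasure lborel (ball 0 1 :: (real ^ 'n) set)"
    by (rule emeasure_Diff) (auto simp: emeasure_ball)
  also have "\<dots> = ennreal (unit_ball_vol (real ?n) * (2 ^ ?n - 1))"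
    by (simp add: emeasure_ball ennreal_minus algebra_simps)
  finally have A: "emeasure lborel ?A = ennreal (unit_ball_vol (real ?n) * (2 ^ ?n - 1))" .
  have "0 < unit_ball_vol (real ?n) * (2 ^ ?n - 1)"
    using dim one_less_power[of "2::real" "CARD('n)"] by simp
  then have a: "0 < a" "emeasure lborel ?A = ennreal a"
    using A by (simp_all add: a_def measure_def)
  have "rough_maximal \<Omega> f x \<le> ennreal (2 ^ ?n * C / a * N) * ennreal (riesz_potential1 (\<lambda>y. norm (gradient f y)) x)"
    if \<Omega>: "homogeneous_deg0 \<Omega>" "\<Omega> \<in> borel_measurable sphere_measure" "weak_Ln_norm \<Omega> \<le> ennreal N" and N: "0 < N"
      and f: "test_function f" for \<Omega> f :: "real ^ 'n \<Rightarrow> complex" and x N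
  proof -
    let ?g = "\<lambda>y. norm (gradient f y)"
    obtain w where w: "weak_homogeneous_weight N w" and \<Omega>_w: "AE y in lborel. norm (\<Omega> y) = w y"
      using ex_weak_homogeneous_weight[OF \<Omega> N] by blast
    obtain R where R: "\<And>x. R \<le> norm x \<Longrightarrow> f x = 0" "\<And>x. R \<le> norm x \<Longrightarrow> gradient f x = 0"
      using test_function_support[OF f] by blast
    have potential: "ennreal (riesz_potential1 ?g x)
        = (\<integral>\<^sup>+z. ennreal (?g z * norm (x - z) powr (1 - real ?n)) \<partial>lborel)"
      using R(2) by (intro riesz_potential1_eq_nn_integral[OF dim continuous_on_norm_gradient[OF f], of R]) auto
    have "ennreal (1 / t ^ CARD('n)) * (\<integral>\<^sup>+y\<in>ball 0 t. ennreal (norm (\<Omega> y * f (x - y))) \<partial>lebesgue)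
        \<le> ennreal (2 ^ ?n * C / a * N) * ennreal (riesz_potential1 ?g x)" if t: "0 < t" for t
    proof -
      let ?X = "\<integral>\<^sup>+y. indicator (ball 0 t) y * ennreal (w y * norm (f (x - y))) \<partial>lborel"
      have X: "?X * ennreal a \<le> ennreal (2 ^ ?n * (C * N * t ^ ?n)) * ennreal (riesz_potential1 ?g x)"
        unfolding a(2)[symmetric] potential
      proof (rule nn_integral_weight_times_le)
        show "(f has_derivative frechet_derivative f (at u)) (at u)" for u
          by (rule test_function_has_derivative[OF f])
        show "norm (frechet_derivative f (at u) v) \<le> ?g u * norm v" for u v
          by (rule norm_frechet_derivative_le_gradient[OF f])
        show "continuous_on UNIV ?g"
          by (rule continuous_on_norm_gradient[OF f])
      qed (use w kernel[OF w N t] C N t R(1) in \<open>auto simp: weak_homogeneous_weight_def\<close>)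
      have "(\<integral>\<^sup>+y\<in>ball 0 t. ennreal (norm (\<Omega> y * f (x - y))) \<partial>lebesgue) = ?X"
        unfolding nn_integral_completion using \<Omega>_w
        by (intro nn_integral_cong_AE) (auto elim!: eventually_mono simp: norm_mult mult.commute)
      then have "ennreal (1 / t ^ CARD('n)) * (\<integral>\<^sup>+y\<in>ball 0 t. ennreal (norm (\<Omega> y * f (x - y))) \<partial>lebesgue)
          = ennreal (1 / (t ^ ?n * a)) * (?X * ennreal a)"
        using t a by (simp add: mult.commute[of ?X] mult.assoc[symmetric] flip: ennreal_mult)
      also have "\<dots> \<le> ennreal (1 / (t ^ ?n * a)) *
          (ennreal (2 ^ ?n * (C * N * t ^ ?n)) * ennreal (riesz_potential1 ?g x))"
        by (intro mult_left_mono X) simp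
      also have "\<dots> = ennreal (2 ^ ?n * C / a * N) * ennreal (riesz_potential1 ?g x)"
        using t a C N by (simp add: mult.assoc[symmetric] flip: ennreal_mult)
      finally show ?thesis .
    qed
    then show ?thesis
      unfolding rough_maximal_def by (intro SUP_least) auto
  qed
  then show ?thesis
    using C a by (intro exI[of _ "2 ^ ?n * C / a"]) simp
qed

theorem corollary1p2:
  assumes "CARD('n) \<ge> 2"
  shows "\<exists>C::real. C \<ge> 0 \<and>
    (\<forall>(\<Omega> :: real ^ 'n \<Rightarrow> complex) (f :: real ^ 'n \<Rightarrow> complex) (x :: real ^ 'n).
       homogeneous_deg0 \<Omega> \<longrightarrow> in_weak_Ln \<Omega> \<longrightarrow> test_function f \<longrightarrow>
       rough_maximal \<Omega> f x
         \<le> ennreal C * weak_Ln_norm \<Omega> * ennreal (riesz_potential1 (\<lambda>y. norm (gradient f y)) x))"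
proof -
  obtain C where C: "0 \<le> C" and bound: "\<And>(\<Omega> :: real ^ 'n \<Rightarrow> complex) f x N.
    homogeneous_deg0 \<Omega> \<Longrightarrow> \<Omega> \<in> borel_measurable sphere_measure \<Longrightarrow> weak_Ln_norm \<Omega> \<le> ennreal N \<Longrightarrow> 0 < N \<Longrightarrow>
    test_function f \<Longrightarrow>
    rough_maximal \<Omega> f x \<le> ennreal (C * N) * ennreal (riesz_potential1 (\<lambda>y. norm (gradient f y)) x)"
    using ex_rough_maximal_bound[OF assms] by blast
  have "rough_maximal \<Omega> f x
      \<le> ennreal C * weak_Ln_norm \<Omega> * ennreal (riesz_potential1 (\<lambda>y. norm (gradient f y)) x)"
    if \<Omega>: "homogeneous_deg0 \<Omega>" "in_weak_Ln \<Omega>" and f: "test_function f" for \<Omega> f :: "real ^ 'n \<Rightarrow> complex" and x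
  proof -
    define r where "r = riesz_potential1 (\<lambda>y. norm (gradient f y)) x"
    have r: "0 \<le> r"
      by (auto simp: r_def riesz_potential1_def intro!: integral_nonneg_AE)
    obtain W where W: "weak_Ln_norm \<Omega> = ennreal W" "0 \<le> W"
      using \<Omega>(2) by (cases "weak_Ln_norm \<Omega>") (auto simp: in_weak_Ln_def)
    \<comment> \<open>Apply the bound to the positive numbers \<open>W + \<delta>\<close> and let \<open>\<delta>\<close> tend to \<open>0\<close>.\<close>
    have "rough_maximal \<Omega> f x \<le> ennreal (C * W * r)"
    proof (rule ennreal_le_epsilon)
      fix e :: real assume e: "0 < e"
      define \<delta> where "\<delta> = e / (C * r + 1)"
      have pos: "0 < C * r + 1"
        using C r by (simp add: add_nonneg_pos)
      then have \<delta>: "0 < \<delta>" "C * r * \<delta> \<le> e"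
        using e by (simp_all add: \<delta>_def field_simps)
      have "rough_maximal \<Omega> f x \<le> ennreal (C * (W + \<delta>)) * ennreal r"
        unfolding r_def using \<Omega> W \<delta> f by (intro bound) (auto simp: in_weak_Ln_def ennreal_leI)
      also have "\<dots> = ennreal (C * (W + \<delta>) * r)"
        using C W \<delta> r by (simp flip: ennreal_mult)
      also have "\<dots> \<le> ennreal (C * W * r + e)"
        using \<delta>(2) by (intro ennreal_leI) (simp add: algebra_simps)
      also have "\<dots> = ennreal (C * W * r) + ennreal e"
        using C W r e by simp
      finally show "rough_maximal \<Omega> f x \<le> ennreal (C * W * r) + ennreal e" .
    qed
    also have "\<dots> = ennreal C * weak_Ln_norm \<Omega> * ennreal r"
      using C W r by (simp add: ennreal_mult)
    finally show ?thesis
      by (simp add: r_def)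
  qed
  then show ?thesis
    using C by blast
qed

end
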